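(* Let $\Lambda=\{\lambda_k\}_{k\in I}$ be a regularizable sequence of nonzero complex numbers of order $\mu$ satisfying the standing assumptions of the context, let $m=\lfloor\mu\rfloor$, let $n\ge1$, and let $z_1,\dots,z_n\in\mathbb{C}\setminus\Lambda$. Then the discrepancy $F=F(\Lambda-z_1,\dots,\Lambda-z_n)$ between the sequences $\Lambda-z_1,\dots,\Lambda-z_n$ is given by $$ F=\Big(1-\frac1n\Big)\sum_{j=1}^{n}\sum_{\ell=2}^{m}\frac{\operatorname{Res}\zeta_\Lambda(\ell)\,H_{\ell-1}}{\ell}z_j^\ell-\frac1n\sum_{1\le j_1<j_2\le n}\sum_{\ell=2}^{m}\sum_{r=1}^{\ell-1}\frac{\operatorname{Res}\zeta_\Lambda(\ell)\,z_{j_1}^{r}z_{j_2}^{\ell-r}}{r(\ell-r)} . $$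
   Context: Standing setting. $\Lambda=\{\lambda_k\}_{k\in I}$ is a countable sequence of nonzero complex numbers whose order $\mu=\inf\{s\in\mathbb{R}:\sum_{k}|\lambda_k|^{-s}<\infty\}$ exists, is finite and positive. Put $\zeta_\Lambda(s)=\sum_k\lambda_k^{-s}$ for $\mathrm{Re}(s)>\mu$ and $\theta_\Lambda(t)=\sum_k e^{-t\lambda_k}$ for $t>0$. It is assumed that these are related by $\zeta_\Lambda(s)=\frac1{\Gamma(s)}\int_0^\infty\theta_\Lambda(t)t^{s-1}\,dt$, and that as $t\to0^+$ there is an asymptotic expansion $\theta_\Lambda(t)\sim\sum_{n\ge0}c_{i_n}t^{i_n}$, with $i_n$ increasing real numbers, $i_0<0$, $i_n\to\infty$, $c_{i_n}$ constants, and $-i_0=\mu$. Under these assumptions $\zeta_\Lambda$ continues meromorphically to $\mathbb{C}$ with at most simple poles, located only at points $s=-i_n$, and is holomorphic at $s=0$. A sequence is called regularizable if its zeta function continues meromorphically to a region containing $s=0$ and is holomorphic at $s=0$; its zeta regularized product is then $\exp(-\zeta'(0))$, $\zeta$ being its zeta function. For $z_1,\dots,z_n\notin\Lambda$, the zeta function of the pointwise product sequence $\{(\lambda_k-z_1)\cdots(\lambda_k-z_n)\}_k$ is $\zeta_\Lambda(s;z)=\sum_k\prod_{j=1}^n(\lambda_k-z_j)^{-s}$, and that of $\Lambda-z_j=\{\lambda_k-z_j\}_k$ is $\zeta_{\Lambda-z_j}(s)=\sum_k(\lambda_k-z_j)^{-s}$; all these sequences are regularizable. The discrepancy is $$F(\Lambda-z_1,\dots,\Lambda-z_n)=\sum_{j=1}^n\zeta_{\Lambda-z_j}'(0)-\partial_s\zeta_\Lambda(0;z),$$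 i.e. the logarithm of the ratio of the zeta regularized product of $\{\prod_j(\lambda_k-z_j)\}_k$ to the product over $j$ of the zeta regularized products of $\{\lambda_k-z_j\}_k$. Branch convention: $\lambda_k^{-s}=e^{-s\log\lambda_k}$ with the principal logarithm, and $(\lambda_k-z_j)^{-s}=e^{-s\log(\lambda_k-z_j)}$ with $\log(\lambda_k-z_j)=\log\lambda_k+\mathrm{Log}(1-z_j/\lambda_k)$ (principal $\mathrm{Log}$) whenever $|\lambda_k|>|z_j|$; for the finitely many other $k$ any branch is allowed, the same choice being used in $\zeta_{\Lambda-z_j}(s)$ and in $\zeta_\Lambda(s;z)$. $\operatorname{Res}\zeta_\Lambda(\ell)$ is the residue of $\zeta_\Lambda$ at $\ell$ (zero if there is no pole), and $H_n=\sum_{i=1}^n 1/i$. *)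

theory Defs
  imports "HOL-Complex_Analysis.Complex_Analysis"
begin

text \<open>
  Complex powers of a sequence depend on branches of the logarithm, so the zeta function of a
  sequence \<open>a\<close> is built from the family \<open>P\<close> of its powers, \<open>P k s\<close> being the chosen value of
  \<open>a\<^sub>k\<close> to the power \<open>-s\<close>.
\<close>

definition zeta_series :: "'i set \<Rightarrow> ('i \<Rightarrow> complex \<Rightarrow> complex) \<Rightarrow> complex \<Rightarrow> complex" where
  "zeta_series I P s = (\<Sum>\<^sub>\<infinity>k\<in>I. P k s)"

definition theta_series :: "'i set \<Rightarrow> ('i \<Rightarrow> complex) \<Rightarrow> real \<Rightarrow> complex" where
  "theta_series I a t = (\<Sum>\<^sub>\<infinity>k\<in>I. exp (- (of_real t * a k)))"

text \<open>Valued in the extended reals, so that the order is finite exactly if it equals a real.\<close>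

definition seq_order :: "'i set \<Rightarrow> ('i \<Rightarrow> complex) \<Rightarrow> ereal" where
  "seq_order I a = Inf (ereal ` {s. (\<lambda>k. cmod (a k) powr (- s)) summable_on I})"

definition principal_powers :: "('i \<Rightarrow> complex) \<Rightarrow> 'i \<Rightarrow> complex \<Rightarrow> complex" where
  "principal_powers a k s = a k powr (- s)"

definition zeta_continuation ::
  "'i set \<Rightarrow> ('i \<Rightarrow> complex \<Rightarrow> complex) \<Rightarrow> complex set \<Rightarrow> (complex \<Rightarrow> complex) \<Rightarrow> bool" where
  "zeta_continuation I P D f \<longleftrightarrow>
     open D \<and> connected D \<and> f meromorphic_on D \<and>
     (\<exists>\<sigma>. {s. Re s > \<sigma>} \<subseteq> D \<and>
        (\<forall>s. Re s > \<sigma> \<longrightarrow> (\<lambda>k. P k s) summable_on I \<and> f s = zeta_series I P s))"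

definition zeta_continuation_0 ::
  "'i set \<Rightarrow> ('i \<Rightarrow> complex \<Rightarrow> complex) \<Rightarrow> (complex \<Rightarrow> complex) \<Rightarrow> bool" where
  "zeta_continuation_0 I P f \<longleftrightarrow>
     (\<exists>D. zeta_continuation I P D f \<and> 0 \<in> D \<and> f analytic_on {0})"

definition regularizable :: "'i set \<Rightarrow> ('i \<Rightarrow> complex \<Rightarrow> complex) \<Rightarrow> bool" where
  "regularizable I P \<longleftrightarrow> (\<exists>f. zeta_continuation_0 I P f)"

text \<open>
  The choices in the next two definitions do not matter if the zeta function continues
  meromorphically to the whole plane: by the identity theorem, any two continuations then agree
  on their common domain up to their values at isolated points (which the library's notion of
  meromorphy leaves open), and those affect neither the residues nor the derivative at a point
  of analyticity.
\<close>

definition zeta_deriv_0 :: "'i set \<Rightarrow> ('i \<Rightarrow> complex \<Rightarrow> complex) \<Rightarrow> complex" where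
  "zeta_deriv_0 I P = deriv (SOME f. zeta_continuation_0 I P f) 0"

definition zeta_residue :: "'i set \<Rightarrow> ('i \<Rightarrow> complex \<Rightarrow> complex) \<Rightarrow> complex \<Rightarrow> complex" where
  "zeta_residue I P w = residue (SOME f. zeta_continuation I P UNIV f) w"

text \<open>
  \<open>L k\<close> is an admissible choice of the logarithm of \<open>a\<^sub>k - z\<close>: it is prescribed if \<open>a\<^sub>k\<close> exceeds
  \<open>z\<close> in modulus, and arbitrary otherwise.
\<close>

definition shifted_logs ::
  "'i set \<Rightarrow> ('i \<Rightarrow> complex) \<Rightarrow> complex \<Rightarrow> ('i \<Rightarrow> complex) \<Rightarrow> bool" where
  "shifted_logs I a z L \<longleftrightarrow>
     (\<forall>k\<in>I. exp (L k) = a k - z \<and>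
            (cmod (a k) > cmod z \<longrightarrow> L k = Ln (a k) + Ln (1 - z / a k)))"

definition log_powers :: "('i \<Rightarrow> complex) \<Rightarrow> 'i \<Rightarrow> complex \<Rightarrow> complex" where
  "log_powers L k s = exp (- (s * L k))"

text \<open>
  The discrepancy of \<open>n\<close> sequences indexed by \<open>I\<close>, the \<open>j\<close>-th of which is given by its logarithms
  \<open>L j\<close>; these determine the sequence as well as all the powers involved.
\<close>

definition discrepancy :: "'i set \<Rightarrow> nat \<Rightarrow> (nat \<Rightarrow> 'i \<Rightarrow> complex) \<Rightarrow> complex" where
  "discrepancy I n L =
     (\<Sum>j=1..n. zeta_deriv_0 I (log_powers (L j))) -
     zeta_deriv_0 I (\<lambda>k s. \<Prod>j=1..n. log_powers (L j) k s)"

end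

theory Submission
  imports Defs
begin

text \<open>
  With \<open>A\<^sub>k = n Ln \<lambda>\<^sub>k - \<Sum>\<^sub>j log (\<lambda>\<^sub>k - z\<^sub>j)\<close>, which is asymptotically a power series \<open>\<Sum>\<^sub>l a\<^sub>l \<lambda>\<^sub>k\<^sup>-\<^sup>l\<close>
  with \<open>a\<^sub>l = \<Sum>\<^sub>j z\<^sub>j\<^sup>l / l\<close>, the zeta function of the product sequence is
  \<open>\<Sum>\<^sub>k \<lambda>\<^sub>k\<^sup>-\<^sup>n\<^sup>s exp (s A\<^sub>k)\<close>. Expanding the exponential up to order \<open>M\<close> in \<open>1 / \<lambda>\<^sub>k\<close> turns it into
  \<open>\<Sum>\<^sub>l p\<^sub>l(s) \<zeta>(n s + l)\<close> plus a tail that converges for \<open>n Re s > \<mu> - M - 1\<close>; this gives the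
  continuation to the whole plane. Since \<open>p\<^sub>l(s) = a\<^sub>l s + s\<^sup>2 [A\<^sup>2]\<^sub>l / 2 + O(s\<^sup>3)\<close> for \<open>l \<ge> 1\<close> and
  \<open>\<zeta>(n s + l) = R\<^sub>l / (n s) + h\<^sub>l + O(s)\<close>, the derivative at \<open>0\<close> consists of terms that are
  additive in the sequences and cancel in the discrepancy, and of
  \<open>\<Sum>\<^sub>l R\<^sub>l [A\<^sup>2]\<^sub>l / (2 n)\<close>, which is quadratic in the \<open>a\<^sub>l\<close> and yields the formula. That the poles
  of \<open>\<zeta>\<close> are simple, with none at \<open>0\<close>, comes from the expansion of \<open>\<theta>\<close> through the Mellin transform.
\<close>

subsection \<open>Uniqueness and gluing of meromorphic continuations\<close>

text \<open>The identity theorem, applied to \<open>remove_sings\<close> of the difference: it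
  vanishes near a point of \<open>U\<close>, hence on all of \<open>D\<close>. The conclusion is
  confined to punctured neighbourhoods because a meromorphic function may take arbitrary values at
  isolated points.\<close>

lemma meromorphic_on_eq_eventually:
  assumes "f meromorphic_on D" "g meromorphic_on D" "open D" "connected D"
    and U: "open U" "U \<noteq> {}" "U \<subseteq> D" "\<And>s. s \<in> U \<Longrightarrow> f s = g s"
    and w: "w \<in> D"
  shows "eventually (\<lambda>s. f s = g s) (at w)"
proof -
  define d where "d = remove_sings (\<lambda>s. f s - g s)"
  have mer: "(\<lambda>s. f s - g s) meromorphic_on D"
    using assms(1,2) by (intro meromorphic_intros)
  have d_eq: "eventually (\<lambda>s. d s = f s - g s) (at x)" if "x \<in> D" for x
    unfolding d_def using meromorphic_on_isolated_singularity[OF meromorphic_on_subset[OF mer]] that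
    by (intro eventually_remove_sings_eq_at) auto
  obtain u where u: "u \<in> U" using U by auto
  have "eventually (\<lambda>s. s \<in> U) (at u)"
    using u U by (intro eventually_at_in_open') auto
  with d_eq[of u] have "eventually (\<lambda>s. d s = 0) (at u)"
    using u U by (auto elim!: eventually_elim2)
  then have "frequently (\<lambda>s. d s = 0) (at u)"
    by (intro eventually_frequently) auto
  then have d0: "d x = 0" if "x \<in> D" for x
    using frequently_eq_meromorphic_imp_constant[of d 0 u D x] that u U assms
      remove_sings_nicely_meromorphic[OF mer] by (auto simp: d_def)
  have "eventually (\<lambda>s. s \<in> D) (at w)"
    using w assms by (intro eventually_at_in_open') auto
  with d_eq[OF w] show ?thesis
    by eventually_elim (use d0 in auto)
qed

lemma half_plane_nonempty: "{s. Re s > x} \<noteq> {}"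
  by (auto intro!: exI[of _ "complex_of_real (x + 1)"])

text \<open>Both functions equal the series on the smaller of the two half-planes, which lies in
  \<open>D\<close>. With \<open>D \<subseteq> D'\<close> the common domain is \<open>D\<close>
  itself and so connected, as the identity theorem requires.\<close>

lemma zeta_continuation_eq_eventually:
  assumes f: "zeta_continuation I P D f" and g: "zeta_continuation I P D' g"
    and "D \<subseteq> D'" and w: "w \<in> D"
  shows "eventually (\<lambda>s. f s = g s) (at w)"
proof -
  from f obtain a where D: "open D" "connected D" "f meromorphic_on D" "{s. Re s > a} \<subseteq> D"
      and fa: "\<And>s. Re s > a \<Longrightarrow> f s = zeta_series I P s"
    by (auto simp: zeta_continuation_def)
  from g obtain b where g': "g meromorphic_on D'"
      and gb: "\<And>s. Re s > b \<Longrightarrow> g s = zeta_series I P s"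
    by (auto simp: zeta_continuation_def)
  show ?thesis
  proof (rule meromorphic_on_eq_eventually[where U = "{s. Re s > max a b}"])
    show "g meromorphic_on D" using g' \<open>D \<subseteq> D'\<close> by (rule meromorphic_on_subset)
    show "{s. Re s > max a b} \<subseteq> D" using D(4) by auto
    show "open {s. Re s > max a b}" by (rule open_halfspace_Re_gt)
    show "{s. Re s > max a b} \<noteq> {}" by (rule half_plane_nonempty)
  qed (use D fa gb w in auto)
qed

text \<open>The \<open>g M\<close> share the values \<open>Z\<close> on a half-plane, so they agree
  pairwise off isolated points. The glued function has to equal \<open>Z\<close> everywhere on
  \<open>Re s > \<sigma>\<close>, because a zeta continuation must coincide with its series
  there.\<close>

lemma meromorphic_on_union_of_half_planes:
  fixes g :: "nat \<Rightarrow> complex \<Rightarrow> complex"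
  assumes mer: "\<And>M. g M meromorphic_on {s. Re s > - real M}"
    and eq: "\<And>M s. Re s > \<sigma> \<Longrightarrow> g M s = Z s"
  shows "\<exists>f. f meromorphic_on UNIV \<and> (\<forall>s. Re s > \<sigma> \<longrightarrow> f s = Z s) \<and>
    (\<forall>M w. Re w > - real M \<longrightarrow> eventually (\<lambda>s. f s = g M s) (at w))"
proof -
  define H where "H = (\<lambda>M. {s. Re s > - real M})"
  have H: "open (H M)" "connected (H M)" for M
    unfolding H_def by (auto simp: open_halfspace_Re_gt intro: convex_connected convex_halfspace_Re_gt)
  have gg: "eventually (\<lambda>s. g M s = g M' s) (at w)" if "w \<in> H M" "w \<in> H M'" for M M' w
  proof -
    show ?thesis
    \<comment> \<open>The bound \<open>0\<close> places the half-plane of agreement inside every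
      \<open>H M\<close>, including \<open>H 0\<close>, when \<open>\<sigma>\<close> is
      negative.\<close>
    proof (rule meromorphic_on_eq_eventually[of _ "H M \<inter> H M'" _ "{s. Re s > max \<sigma> 0}"])
      show "connected (H M \<inter> H M')"
        unfolding H_def
        by (intro convex_connected convex_Int convex_halfspace_Re_gt)
      show "g M meromorphic_on H M \<inter> H M'"
        by (rule meromorphic_on_subset[OF mer]) (auto simp: H_def)
      show "g M' meromorphic_on H M \<inter> H M'"
        by (rule meromorphic_on_subset[OF mer]) (auto simp: H_def)
      show "open {s. Re s > max \<sigma> 0}" by (rule open_halfspace_Re_gt)
      show "{s. Re s > max \<sigma> 0} \<noteq> {}" by (rule half_plane_nonempty)
      show "{s. Re s > max \<sigma> 0} \<subseteq> H M \<inter> H M'" by (auto simp: H_def)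
      show "open (H M \<inter> H M')" using H by auto
      show "g M s = g M' s" if "s \<in> {s. Re s > max \<sigma> 0}" for s
        using that eq[of s] by simp
    qed (use that in auto)
  qed
  \<comment> \<open>The added \<open>1\<close> makes \<open>Re s > - real (ix s)\<close> strict.
    Below, \<open>remove_sings\<close> gives the same value for every index \<open>M\<close> with
    \<open>s \<in> H M\<close>, since it depends only on the punctured germ.\<close>
  define ix where "ix = (\<lambda>s. nat \<lceil>- Re s\<rceil> + 1)"
  define f where "f = (\<lambda>s. if Re s > \<sigma> then Z s else remove_sings (g (ix s)) s)"
  have ix: "s \<in> H (ix s)" for s by (auto simp: H_def ix_def) linarith
  have iso: "isolated_singularity_at (g M) w" if "w \<in> H M" for M w
    using mer[of M] that unfolding H_def
    by (meson meromorphic_on_isolated_singularity meromorphic_on_meromorphic_at)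
  have rs: "remove_sings (g M) s = remove_sings (g M') s" if "s \<in> H M" "s \<in> H M'" for M M' s
    by (rule remove_sings_cong) (use gg[OF that] in auto)
  have loc: "eventually (\<lambda>s. f s = g M s) (at w)" if "w \<in> H M" for M w
  proof -
    have "eventually (\<lambda>s. s \<in> H M) (at w)"
      using that H by (intro eventually_at_in_open') auto
    moreover have "eventually (\<lambda>s. remove_sings (g M) s = g M s) (at w)"
      by (rule eventually_remove_sings_eq_at[OF iso[OF that]])
    ultimately show ?thesis
      by eventually_elim (use eq rs[OF _ ix] in \<open>auto simp: f_def\<close>)
  qed
  show ?thesis
  proof (intro exI[of _ f] conjI)
    show "f meromorphic_on UNIV"
    proof (subst meromorphic_on_meromorphic_at, safe)
      fix w
      have "g (ix w) meromorphic_on {w}"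
        using mer[of "ix w"] by (rule meromorphic_on_subset) (use ix in \<open>auto simp: H_def\<close>)
      then show "f meromorphic_on {w}"
        using meromorphic_on_cong[of "{w}" f "g (ix w)" "{w}"] loc[OF ix] by auto
    qed
  qed (use loc in \<open>auto simp: f_def H_def\<close>)
qed

section \<open>Residues and derivatives at zero of a chosen continuation\<close>

lemma zeta_residue_eq:
  assumes "zeta_continuation I P UNIV g"
  shows "zeta_residue I P w = residue g w"
proof -
  have "zeta_continuation I P UNIV (SOME f. zeta_continuation I P UNIV f)"
    using someI[of "zeta_continuation I P UNIV", OF assms] .
  then have "eventually (\<lambda>s. (SOME f. zeta_continuation I P UNIV f) s = g s) (at w)"
    by (rule zeta_continuation_eq_eventually[OF _ assms]) auto
  then show ?thesis
    unfolding zeta_residue_def by (rule residue_cong) auto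
qed

text \<open>The continuation \<open>g\<close> need not have the right value at \<open>0\<close>, so
  it is corrected there by \<open>h 0\<close>; hence the choice defining \<open>zeta_deriv_0\<close>
  is made from a nonempty class. The chosen function agrees with \<open>h\<close> on a punctured
  neighbourhood of \<open>0\<close>, and continuity extends this to \<open>0\<close> itself.\<close>

lemma zeta_deriv_0_eq:
  assumes g: "zeta_continuation I P UNIV g"
    and gh: "eventually (\<lambda>s. g s = h s) (at 0)" and h: "h analytic_on {0}"
  shows "zeta_deriv_0 I P = deriv h 0"
proof -
  define g' where "g' = remove_sings g"
  define f where "f = (SOME f. zeta_continuation_0 I P f)"
  from g obtain \<sigma> where mer: "g meromorphic_on UNIV" and sm: "\<And>s. Re s > \<sigma> \<Longrightarrow> (\<lambda>k. P k s) summable_on I"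
      and eq: "\<And>s. Re s > \<sigma> \<Longrightarrow> g s = zeta_series I P s"
    by (auto simp: zeta_continuation_def)
  have "zeta_continuation I P UNIV (\<lambda>s. if s = 0 then h 0 else g s)"
    unfolding zeta_continuation_def
  \<comment> \<open>An abscissa of at least \<open>0\<close> keeps the altered value at
    \<open>0\<close> outside the half-plane where the series must be matched.\<close>
  proof (intro conjI exI[of _ "max \<sigma> 0"] allI impI)
    show "(\<lambda>s. if s = 0 then h 0 else g s) meromorphic_on UNIV"
    proof (subst meromorphic_on_cong)
      show "eventually (\<lambda>s. (if s = 0 then h 0 else g s) = g s) (at w)" for w
        using eventually_neq_at_within[of 0 w UNIV] by eventually_elim auto
    qed (use mer in auto)
  qed (use sm eq in auto)
  moreover have "(\<lambda>s. if s = 0 then h 0 else g s) analytic_on {0}"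
  proof (subst analytic_at_cong)
    show "eventually (\<lambda>s. (if s = 0 then h 0 else g s) = h s) (nhds 0)"
      using gh unfolding eventually_at_filter by eventually_elim auto
  qed (use h in auto)
  ultimately have "zeta_continuation_0 I P (\<lambda>s. if s = 0 then h 0 else g s)"
    unfolding zeta_continuation_0_def by blast
  then have "zeta_continuation_0 I P f"
    unfolding f_def using someI[of "zeta_continuation_0 I P"] by blast
  then obtain D where D: "zeta_continuation I P D f" "0 \<in> D" and f: "f analytic_on {0}"
    unfolding zeta_continuation_0_def by blast
  from zeta_continuation_eq_eventually[OF D(1) g _ D(2)]
  have "eventually (\<lambda>s. f s = g s) (at 0)" by auto
  with gh have ev: "eventually (\<lambda>s. f s = h s) (at 0)"
    by eventually_elim auto
  have "f \<midarrow>0\<rightarrow> f 0" "h \<midarrow>0\<rightarrow> h 0"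
    using f h analytic_at_imp_isCont isContD by blast+
  with ev have "f 0 = h 0"
    by (metis LIM_unique tendsto_cong)
  with ev have "eventually (\<lambda>s. f s = h s) (nhds 0)"
    unfolding eventually_at_filter by (auto elim!: eventually_mono)
  then have "deriv f 0 = deriv h 0"
    by (rule deriv_cong_ev) auto
  then show ?thesis unfolding zeta_deriv_0_def f_def .
qed

text \<open>The value \<open>k w\<close> is the residue, and the difference quotient of
  \<open>k\<close>, completed by \<open>deriv k w\<close>, is the regular part. The case
  \<open>k w = 0\<close> covers removable singularities.\<close>

lemma pole_order_le_1_laurent:
  assumes k: "k analytic_on {w}" and f: "eventually (\<lambda>s. (s - w) * f s = k s) (at w)"
  obtains h where "h analytic_on {w}" "eventually (\<lambda>s. f s = k w / (s - w) + h s) (at w)"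
    "residue f w = k w"
proof -
  define h where "h = (\<lambda>z. if z = w then deriv k w else f z - k w / (z - w))"
  obtain d where d: "d > 0" "\<And>s. s \<in> ball w d - {w} \<Longrightarrow> k s = (s - w) * f s"
    using f unfolding eventually_at by (auto simp: dist_commute)
  have "h analytic_on {w}"
    unfolding h_def by (rule pole_theorem_analytic[OF k]) (use d in blast)
  moreover have "eventually (\<lambda>s. f s = k w / (s - w) + h s) (at w)"
    using eventually_neq_at_within[of w w UNIV] by eventually_elim (auto simp: h_def)
  moreover obtain r where r: "r > 0" "k holomorphic_on ball w r"
    using k by (auto simp: analytic_on_def)
  have "residue (\<lambda>s. k s / (s - w)) w = k w"
    by (rule residue_simple[OF _ _ r(2)]) (use r in auto)
  moreover have "residue f w = residue (\<lambda>s. k s / (s - w)) w"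
  proof (rule residue_cong)
    show "eventually (\<lambda>s. f s = k s / (s - w)) (at w)"
      using f eventually_neq_at_within[of w w UNIV] by eventually_elim (auto simp: field_simps)
  qed auto
  ultimately show ?thesis using that by metis
qed

subsection \<open>Mellin transforms\<close>

lemma norm_exp_minus_1_le: "norm (exp z - 1) \<le> norm z * exp (norm (z :: complex))"
  using Taylor_exp_field[of z 0] by (simp add: mult.commute)

text \<open>
  The difference quotients at \<open>s\<close> are dominated by the integrands at \<open>s \<plusminus> 2\<delta>\<close>, so integrability on
  an open set suffices.
\<close>

lemma holomorphic_on_exp_integral:
  fixes g :: "'a \<Rightarrow> complex" and u :: "'a \<Rightarrow> real"
  assumes S: "open S" and int: "\<And>s. s \<in> S \<Longrightarrow> integrable M (\<lambda>x. g x * exp (s * of_real (u x)))"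
    and [measurable]: "u \<in> borel_measurable M"
  shows "(\<lambda>s. \<integral>x. g x * exp (s * of_real (u x)) \<partial>M) holomorphic_on S"
proof -
  define F where "F = (\<lambda>s. \<integral>x. g x * exp (s * of_real (u x)) \<partial>M)"
  have "\<exists>D. (F has_field_derivative D) (at s)" if s: "s \<in> S" for s
  proof -
    obtain r where r: "r > 0" "cball s r \<subseteq> S"
      using S s open_contains_cball by blast
    define \<delta> where "\<delta> = r / 2"
    have \<delta>: "\<delta> > 0" using r by (simp add: \<delta>_def)
    have in_S: "s + h \<in> S" if "norm h \<le> 2 * \<delta>" for h
      using r that by (auto simp: \<delta>_def dist_norm subset_iff)
    have [measurable]: "(\<lambda>x. g x * exp (s * of_real (u x))) \<in> borel_measurable M"
      using int[OF s] by auto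
    define w where "w = (\<lambda>x. (1 / \<delta>) * (norm (g x * exp ((s + of_real (2 * \<delta>)) * of_real (u x))) +
        norm (g x * exp ((s + of_real (- (2 * \<delta>))) * of_real (u x)))))"
    define D where "D = (\<integral>x. g x * exp (s * of_real (u x)) * of_real (u x) \<partial>M)"
    define q where "q = (\<lambda>h x. (g x * exp ((s + h) * of_real (u x)) - g x * exp (s * of_real (u x))) / h)"
    have w_int: "integrable M w"
      unfolding w_def
      by (intro integrable_mult_right Bochner_Integration.integrable_add integrable_norm int in_S)
         (use \<delta> in auto)
    have q_int: "integrable M (q h)" "(F (s + h) - F s) / h = (\<integral>x. q h x \<partial>M)" if "norm h \<le> 2 * \<delta>" for h
      using int[OF in_S[OF that]] int[OF s] unfolding q_def F_def by auto
    have bound: "norm (q h x) \<le> w x" if h: "norm h < \<delta>" "h \<noteq> 0" for h x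
    proof -
      let ?u = "\<bar>u x\<bar>"
      have "q h x = g x * exp (s * of_real (u x)) * (exp (h * of_real (u x)) - 1) / h"
        by (simp add: q_def algebra_simps exp_add)
      then have "norm (q h x) = norm (g x * exp (s * of_real (u x))) * (norm (exp (h * of_real (u x)) - 1) / norm h)"
        by (simp add: norm_mult norm_divide)
      also have "norm (exp (h * of_real (u x)) - 1) \<le> (norm h * ?u) * exp (norm h * ?u)"
        using norm_exp_minus_1_le[of "h * of_real (u x)"] by (simp add: norm_mult)
      then have "norm (exp (h * of_real (u x)) - 1) / norm h \<le> ?u * exp (norm h * ?u)"
        using h by (simp add: field_simps)
      \<comment> \<open>One \<open>\<delta>\<close> bounds \<open>norm h\<close>, and a second one
        pays for the factor \<open>\<bar>u x\<bar>\<close> through \<open>y \<le> exp y\<close>;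
        this is why the dominating integrands sit at distance \<open>2 * \<delta>\<close>.\<close>
      also have "\<dots> \<le> (exp (\<delta> * ?u) / \<delta>) * exp (\<delta> * ?u)"
      proof (intro mult_mono)
        have "?u * \<delta> \<le> exp (\<delta> * ?u)"
          using exp_ge_add_one_self[of "\<delta> * ?u"] by (simp only: mult.commute)
        then show "?u \<le> exp (\<delta> * ?u) / \<delta>"
          using \<delta> by (simp only: pos_le_divide_eq)
        show "exp (norm h * ?u) \<le> exp (\<delta> * ?u)"
          using h by (auto intro!: mult_right_mono)
      qed (use \<delta> in auto)
      also have "\<dots> = (1 / \<delta>) * exp (2 * \<delta> * ?u)"
        by (simp add: exp_add[symmetric] mult_exp_exp)
      also have "exp (2 * \<delta> * ?u) \<le> exp (2 * \<delta> * u x) + exp (- (2 * \<delta>) * u x)"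
        by (cases "u x \<ge> 0") auto
      also have "norm (g x * exp (s * of_real (u x))) * ((1 / \<delta>) * (exp (2 * \<delta> * u x) + exp (- (2 * \<delta>) * u x))) = w x"
        unfolding w_def norm_mult norm_exp_eq_Re by (simp add: algebra_simps exp_add exp_diff exp_minus divide_inverse)
      finally show ?thesis
        using \<delta> by (simp add: mult_left_mono divide_right_mono)
    qed
    have "((\<lambda>h. (F (s + h) - F s) / h) \<longlongrightarrow> D) (at 0)"
      unfolding tendsto_at_iff_sequentially
    proof safe
      fix X :: "nat \<Rightarrow> complex"
      assume X0: "\<forall>i. X i \<in> UNIV - {0}" and X: "X \<longlonglongrightarrow> 0"
      obtain N where N: "\<And>i. i \<ge> N \<Longrightarrow> norm (X i) < \<delta>"
        using LIMSEQ_D[OF X \<delta>] by auto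
      have "(\<lambda>i. \<integral>x. q (X (i + N)) x \<partial>M) \<longlonglongrightarrow> D"
        unfolding D_def
      proof (rule integral_dominated_convergence[where w = w])
        show "AE x in M. (\<lambda>i. q (X (i + N)) x) \<longlonglongrightarrow> g x * exp (s * of_real (u x)) * of_real (u x)"
        proof (intro AE_I2)
          fix x
          have "((\<lambda>s. g x * exp (s * of_real (u x))) has_field_derivative
              g x * exp (s * of_real (u x)) * of_real (u x)) (at s)"
            by (auto intro!: derivative_eq_intros)
          then have "((\<lambda>h. q h x) \<longlongrightarrow> g x * exp (s * of_real (u x)) * of_real (u x)) (at 0)"
            unfolding q_def DERIV_def .
          then have "(\<lambda>i. q (X i) x) \<longlonglongrightarrow> g x * exp (s * of_real (u x)) * of_real (u x)"
            using X0 X unfolding tendsto_at_iff_sequentially by (auto simp: o_def)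
          then show "(\<lambda>i. q (X (i + N)) x) \<longlonglongrightarrow> g x * exp (s * of_real (u x)) * of_real (u x)"
            by (rule LIMSEQ_ignore_initial_segment)
        qed
        show "AE x in M. norm (q (X (i + N)) x) \<le> w x" for i
          using bound N X0 by auto
        show "q (X (i + N)) \<in> borel_measurable M" for i
          using q_int(1)[of "X (i + N)"] N[of "i + N"] \<delta> by auto
      qed (use w_int in auto)
      also have "(\<lambda>i. \<integral>x. q (X (i + N)) x \<partial>M) = (\<lambda>i. (F (s + X (i + N)) - F s) / X (i + N))"
      proof (intro ext)
        fix i
        show "(\<integral>x. q (X (i + N)) x \<partial>M) = (F (s + X (i + N)) - F s) / X (i + N)"
          using q_int(2)[of "X (i + N)"] N[of "i + N"] \<delta> by auto
      qed
      finally show "((\<lambda>h. (F (s + h) - F s) / h) \<circ> X) \<longlonglongrightarrow> D"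
        unfolding o_def by (rule LIMSEQ_offset)
    qed
    then show ?thesis unfolding DERIV_def by blast
  qed
  then have "F holomorphic_on S"
    using S by (simp add: holomorphic_on_open)
  then show ?thesis unfolding F_def .
qed

text \<open>With \<open>u = ln\<close> the power becomes
  \<open>exp (- ln t) * exp (s * ln t)\<close>, so this is an exponential integral whose weight
  absorbs the shift by \<open>-1\<close>.\<close>

lemma holomorphic_on_mellin:
  assumes A: "A \<in> sets borel" "A \<subseteq> {0<..}" and S: "open S"
    and int: "\<And>s. s \<in> S \<Longrightarrow> set_integrable lborel A (\<lambda>t. g t * of_real t powr (s - 1))"
  shows "(\<lambda>s. LBINT t:A. g t * of_real t powr (s - 1)) holomorphic_on S"
proof -
  define G where "G = (\<lambda>t. indicator A t * g t * exp (- of_real (ln t)))"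
  have eq: "indicator A t *\<^sub>R (g t * of_real t powr (s - 1)) = G t * exp (s * of_real (ln t))" for t s
    using A(2) by (auto simp: G_def powr_def Ln_of_real indicator_def exp_of_real exp_diff exp_minus field_simps subset_iff)
  have "(\<lambda>s. \<integral>t. G t * exp (s * of_real (ln t)) \<partial>lborel) holomorphic_on S"
    by (rule holomorphic_on_exp_integral) (use S int in \<open>auto simp: eq set_integrable_def\<close>)
  then show ?thesis
    by (simp add: set_lebesgue_integral_def eq)
qed

lemma norm_of_real_powr: "t > 0 \<Longrightarrow> norm (complex_of_real t powr z) = t powr Re z"
  by (simp add: norm_powr_real_powr)

lemma of_real_powr_measurable [measurable]:
  "(\<lambda>t. complex_of_real t powr z) \<in> borel_measurable borel"
  unfolding powr_def by measurable

lemma set_integrable_powr_Ioc_01: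
  assumes "a > - 1"
  shows "set_integrable lborel {0<..1} (\<lambda>t::real. t powr a)"
proof -
  have "(\<lambda>t::real. t powr a) integrable_on {0<..1}"
    by (rule integrable_on_powr_from_0') (use assms in auto)
  then have "(\<lambda>t::real. t powr a) absolutely_integrable_on {0<..1}"
    by (intro nonnegative_absolutely_integrable_1) auto
  then show ?thesis
    by (auto simp: set_integrable_def integrable_completion)
qed

text \<open>The source of the poles: used at \<open>s + e i\<close>, the integral turns the term
  \<open>t powr e i\<close> of the expansion into \<open>1 / (s + e i)\<close>.\<close>

lemma mellin_one_Ioc_01:
  assumes "Re s > 0"
  shows "set_integrable lborel {0<..1} (\<lambda>t. complex_of_real t powr (s - 1))"
    and "(LBINT t:{0<..1}. complex_of_real t powr (s - 1)) = 1 / s"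
proof -
  show *: "set_integrable lborel {0<..1} (\<lambda>t. complex_of_real t powr (s - 1))"
  proof (rule set_integrable_bound[OF set_integrable_powr_Ioc_01[of "Re s - 1"]])
    show "set_borel_measurable lborel {0<..1} (\<lambda>t. complex_of_real t powr (s - 1))"
      unfolding set_borel_measurable_def by measurable
  qed (use assms in \<open>auto simp: norm_of_real_powr\<close>)
  have "((\<lambda>t. complex_of_real t powr (s - 1)) has_integral
            (of_real 1 powr s / s - of_real 0 powr s / s)) {0..1}" using assms
      by (intro fundamental_theorem_of_calculus_interior)
         (auto intro!: continuous_intros derivative_eq_intros has_vector_derivative_real_field)
  then have "((\<lambda>t. complex_of_real t powr (s - 1)) has_integral 1 / s) {0..1}"
    by simp
  also have "?this \<longleftrightarrow> ((\<lambda>t. complex_of_real t powr (s - 1)) has_integral 1 / s) {0<..1}"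
    by (rule has_integral_spike_set_eq; rule negligible_subset[of "{0}"]) auto
  finally have "((\<lambda>t. complex_of_real t powr (s - 1)) has_integral 1 / s) {0<..1}" .
  then show "(LBINT t:{0<..1}. complex_of_real t powr (s - 1)) = 1 / s"
    using set_borel_integral_eq_integral(2)[OF *] by (simp add: integral_unique)
qed

lemma powr_le_1_plus:
  assumes "0 < a" "a \<le> t" "t \<le> 1"
  shows "t powr x \<le> 1 + a powr (x :: real)"
proof (cases "x \<ge> 0")
  case True
  then have "t powr x \<le> 1" using assms by (intro powr_le1) auto
  then show ?thesis by (simp add: add_increasing2)
next
  case False
  then have "t powr x \<le> a powr x" using assms by (intro powr_mono2') auto
  then show ?thesis by simp
qed

section \<open>Mellin transform of a function with a power expansion at zero\<close>

locale mellin_asymptotics =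
  fixes \<theta> :: "real \<Rightarrow> complex" and e :: "nat \<Rightarrow> real" and c :: "nat \<Rightarrow> complex"
  assumes integrable: "\<And>s. Re s > - e 0 \<Longrightarrow> set_integrable lborel {0<..} (\<lambda>t. \<theta> t * of_real t powr (s - 1))"
    and e_mono: "strict_mono e"
    and asymp: "\<And>N. (\<lambda>t. \<theta> t - (\<Sum>i\<le>N. c i * of_real (t powr e i)))
              \<in> o[at_right 0](\<lambda>t. of_real (t powr e N))"
begin

lemma e_le: "i \<le> j \<Longrightarrow> e i \<le> e j"
  using e_mono by (simp add: strict_mono_less_eq)

definition remainder :: "nat \<Rightarrow> real \<Rightarrow> complex" where
  "remainder N t = \<theta> t - (\<Sum>i\<le>N. c i * of_real (t powr e i))"

lemma theta_integrable_on:
  assumes "A \<in> sets borel" "A \<subseteq> {0<..}" "Re s > - e 0"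
  shows "set_integrable lborel A (\<lambda>t. \<theta> t * of_real t powr (s - 1))"
  using set_integrable_subset[OF integrable[OF assms(3)]] assms by auto

text \<open>Measurability of \<open>\<theta>\<close> is extracted from the integrability of one
  Mellin integrand by dividing out the power, which does not vanish on \<open>A\<close>;
  \<open>1 - e 0\<close> serves as a sample point of the half-plane of convergence.\<close>

lemma theta_measurable:
  assumes [measurable]: "A \<in> sets borel" and A: "A \<subseteq> {0<..}"
  shows "(\<lambda>t. indicator A t *\<^sub>R \<theta> t) \<in> borel_measurable borel"
proof -
  define s where "s = complex_of_real (1 - e 0)"
  have "(\<lambda>t. indicator A t *\<^sub>R (\<theta> t * of_real t powr (s - 1))) \<in> borel_measurable lborel"
    using theta_integrable_on[OF assms, of s] unfolding set_integrable_def s_def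
    by (auto dest: borel_measurable_integrable)
  then have [measurable]: "(\<lambda>t. indicator A t *\<^sub>R (\<theta> t * of_real t powr (s - 1))) \<in> borel_measurable borel"
    by simp
  have "(\<lambda>t. (indicator A t *\<^sub>R (\<theta> t * of_real t powr (s - 1))) * of_real t powr (1 - s)) \<in> borel_measurable borel"
    by measurable
  also have "(\<lambda>t. (indicator A t *\<^sub>R (\<theta> t * of_real t powr (s - 1))) * of_real t powr (1 - s)) =
      (\<lambda>t. indicator A t *\<^sub>R \<theta> t)"
    using A by (auto simp: indicator_def fun_eq_iff powr_add[symmetric] subset_iff)
  finally show ?thesis .
qed

lemma set_borel_measurable_theta:
  assumes [measurable]: "A \<in> sets borel" and A: "A \<subseteq> {0<..}"
  shows "set_borel_measurable lborel A (\<lambda>t. \<theta> t * of_real t powr (s - 1))"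
proof -
  note [measurable] = theta_measurable[OF assms]
  have "(\<lambda>t. (indicator A t *\<^sub>R \<theta> t) * of_real t powr (s - 1)) \<in> borel_measurable borel"
    by measurable
  then show ?thesis by (simp add: set_borel_measurable_def)
qed

text \<open>For \<open>t > 1\<close> a larger real part of the exponent only enlarges the integrand,
  so every \<open>s\<close> is dominated by a real exponent in the half-plane of
  convergence.\<close>

lemma theta_integrable_at_top:
  "set_integrable lborel {1<..} (\<lambda>t. \<theta> t * of_real t powr (s - 1))"
proof (rule set_integrable_bound)
  show "set_integrable lborel {1<..} (\<lambda>t. \<theta> t * of_real t powr (of_real (max (Re s) (1 - e 0)) - 1))"
    by (rule theta_integrable_on) auto
  show "set_borel_measurable lborel {1<..} (\<lambda>t. \<theta> t * of_real t powr (s - 1))"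
    by (rule set_borel_measurable_theta) auto
qed (auto simp: norm_mult norm_of_real_powr intro!: mult_left_mono powr_mono)

text \<open>Near \<open>0\<close> the asymptotics bound the remainder by \<open>t powr e N\<close>,
  and \<open>t powr (e N + Re s - 1)\<close> is integrable up to \<open>0\<close>. On the rest
  \<open>[a, 1]\<close> all powers of \<open>t\<close> are bounded, so integrability of
  \<open>\<theta>\<close> against one fixed power suffices.\<close>

lemma remainder_integrable:
  assumes s: "Re s > - e N"
  shows "set_integrable lborel {0<..1} (\<lambda>t. remainder N t * of_real t powr (s - 1))"
proof -
  have "eventually (\<lambda>t. norm (remainder N t) \<le> 1 * norm (complex_of_real (t powr e N))) (at_right 0)"
    using landau_o.smallD[OF asymp[of N], of 1] unfolding remainder_def by simp
  then obtain b where b: "b > 0" "\<And>t. t > 0 \<Longrightarrow> t < b \<Longrightarrow> norm (remainder N t) \<le> t powr e N"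
    unfolding eventually_at_right_field by auto
  define a where "a = min b 1"
  have a: "a > 0" "a \<le> 1" "\<And>t. t > 0 \<Longrightarrow> t < a \<Longrightarrow> norm (remainder N t) \<le> t powr e N"
    using b by (auto simp: a_def)
  \<comment> \<open>\<open>K\<close> is the price of replacing \<open>t powr (Re s - 1)\<close> on
    \<open>[a, 1]\<close> by \<open>t powr (- e 0)\<close>, a weight at which
    \<open>\<theta>\<close> is known to be integrable; \<open>K'\<close> bounds the subtracted
    powers. \<open>W\<close> adds the majorants for both parts of the interval.\<close>
  define K where "K = 1 + a powr (Re s - 1 + e 0)"
  define K' where "K' = (\<Sum>i\<le>N. norm (c i) * (1 + a powr (e i + Re s - 1)))"
  have K0: "K \<ge> 0" "K' \<ge> 0"
    unfolding K_def K'_def by (auto intro!: sum_nonneg mult_nonneg_nonneg add_nonneg_nonneg)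
  define W where "W = (\<lambda>t. t powr (e N + Re s - 1) + (K * norm (\<theta> t * of_real t powr (of_real (1 - e 0) - 1)) + K'))"
  show ?thesis
  proof (rule set_integrable_bound)
    have "set_integrable lborel {0<..1} (\<lambda>t. \<theta> t * of_real t powr (of_real (1 - e 0) - 1))"
      by (rule theta_integrable_on) auto
    then show "set_integrable lborel {0<..1} W"
      unfolding W_def
      by (intro set_integral_add set_integrable_powr_Ioc_01 set_integrable_mult_right set_integrable_norm)
         (use s in \<open>auto simp: set_integrable_def\<close>)
    note [measurable] = theta_measurable[of "{0<..1}"]
    have "(\<lambda>t. (indicator {0<..1} t *\<^sub>R \<theta> t - indicator {0<..1} t *\<^sub>R (\<Sum>i\<le>N. c i * of_real (t powr e i))) *
        of_real t powr (s - 1)) \<in> borel_measurable borel"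
      by measurable auto
    then show "set_borel_measurable lborel {0<..1} (\<lambda>t. remainder N t * of_real t powr (s - 1))"
      by (simp add: set_borel_measurable_def remainder_def algebra_simps)
    show "AE t in lborel. t \<in> {0<..1} \<longrightarrow> norm (remainder N t * of_real t powr (s - 1)) \<le> norm (W t)"
    proof (intro AE_I2 impI)
      fix t :: real assume t: "t \<in> {0<..1}"
      have n: "norm (complex_of_real t powr (s - 1)) = t powr (Re s - 1)"
        using t by (simp add: norm_of_real_powr)
      have n': "norm (complex_of_real t powr (of_real (1 - e 0) - 1)) = t powr (- e 0)"
        using t by (simp add: norm_of_real_powr)
      have "norm (remainder N t * of_real t powr (s - 1)) \<le> W t"
      proof (cases "t < a")
        case True
        then have "norm (remainder N t * of_real t powr (s - 1)) \<le> t powr e N * t powr (Re s - 1)"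
          using a t unfolding norm_mult n by (intro mult_right_mono) auto
        also have "\<dots> = t powr (e N + Re s - 1)"
          by (simp add: powr_add[symmetric] algebra_simps)
        also have "\<dots> \<le> W t" using K0 by (simp add: W_def)
        finally show ?thesis .
      next
        case False
        then have ta: "0 < a" "a \<le> t" "t \<le> 1" using a t by auto
        have "norm (remainder N t * of_real t powr (s - 1)) \<le>
            (norm (\<theta> t) + (\<Sum>i\<le>N. norm (c i) * t powr e i)) * t powr (Re s - 1)"
          unfolding norm_mult n remainder_def
          by (intro mult_right_mono order_trans[OF norm_triangle_ineq4] add_mono order_trans[OF norm_sum])
             (auto simp: norm_mult)
        also have "\<dots> = norm (\<theta> t) * t powr (Re s - 1) + (\<Sum>i\<le>N. norm (c i) * t powr (e i + Re s - 1))"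
          using t by (simp add: algebra_simps sum_distrib_left powr_add[symmetric])
        also have "\<dots> \<le> K * norm (\<theta> t * of_real t powr (of_real (1 - e 0) - 1)) + K'"
        proof (rule add_mono)
          have "t powr (Re s - 1) = t powr (Re s - 1 + e 0) * t powr (- e 0)"
            by (simp add: powr_add[symmetric])
          also have "\<dots> \<le> K * t powr (- e 0)"
            unfolding K_def by (intro mult_right_mono powr_le_1_plus ta) auto
          finally show "norm (\<theta> t) * t powr (Re s - 1) \<le> K * norm (\<theta> t * of_real t powr (of_real (1 - e 0) - 1))"
            unfolding norm_mult n' by (metis mult.left_commute mult_left_mono norm_ge_zero)
          show "(\<Sum>i\<le>N. norm (c i) * t powr (e i + Re s - 1)) \<le> K'"
            unfolding K'_def by (intro sum_mono mult_left_mono powr_le_1_plus ta) auto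
        qed
        also have "\<dots> \<le> W t" by (simp add: W_def)
        finally show ?thesis .
      qed
      then show "norm (remainder N t * of_real t powr (s - 1)) \<le> norm (W t)" by simp
    qed
  qed
qed

definition mellin_rest :: "nat \<Rightarrow> complex \<Rightarrow> complex" where
  "mellin_rest N s = (LBINT t:{0<..1}. remainder N t * of_real t powr (s - 1)) +
     (LBINT t:{1<..}. \<theta> t * of_real t powr (s - 1))"

lemma mellin_rest_holomorphic: "mellin_rest N holomorphic_on {s. Re s > - e N}"
  unfolding mellin_rest_def
  by (intro holomorphic_on_add holomorphic_on_mellin)
     (auto intro: remainder_integrable theta_integrable_at_top simp: open_halfspace_Re_gt)

text \<open>The first terms of the expansion are subtracted on \<open>(0, 1]\<close> only and
  integrated exactly. The right side makes sense on \<open>Re s > - e N\<close> apart from the poles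
  \<open>- e i\<close>, and so continues the transform.\<close>

lemma mellin_eq:
  assumes s: "Re s > - e 0"
  shows "(LBINT t:{0<..}. \<theta> t * of_real t powr (s - 1)) = (\<Sum>i\<le>N. c i / (s + of_real (e i))) + mellin_rest N s"
proof -
  have U: "{0<..} = {0<..1} \<union> {1::real<..}" by auto
  have \<theta>1: "set_integrable lborel {0<..1} (\<lambda>t. \<theta> t * of_real t powr (s - 1))"
    by (rule theta_integrable_on) (use s in auto)
  have sN: "Re s > - e i" for i using s e_le[of 0 i] by simp
  have R: "set_integrable lborel {0<..1} (\<lambda>t. remainder N t * of_real t powr (s - 1))"
    by (rule remainder_integrable[OF sN])
  have c_eq: "indicator {0<..1} t *\<^sub>R (c i * (of_real t powr (s + of_real (e i) - 1))) =
      indicator {0<..1} t *\<^sub>R (c i * of_real (t powr e i) * of_real t powr (s - 1))" for i t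
    by (auto simp: indicator_def powr_of_real[symmetric] powr_add[symmetric] algebra_simps)
  have C: "set_integrable lborel {0<..1} (\<lambda>t. c i * of_real (t powr e i) * of_real t powr (s - 1))"
    "(LBINT t:{0<..1}. c i * of_real (t powr e i) * of_real t powr (s - 1)) = c i / (s + of_real (e i))" for i
  proof -
    have pos: "Re (s + of_real (e i)) > 0" using sN[of i] by simp
    have "set_integrable lborel {0<..1} (\<lambda>t. c i * (of_real t powr (s + of_real (e i) - 1)))"
      using mellin_one_Ioc_01(1)[OF pos] by (intro set_integrable_mult_right)
    then show "set_integrable lborel {0<..1} (\<lambda>t. c i * of_real (t powr e i) * of_real t powr (s - 1))"
      by (simp only: set_integrable_def c_eq)
    have "(LBINT t:{0<..1}. c i * of_real (t powr e i) * of_real t powr (s - 1)) =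
        (LBINT t:{0<..1}. c i * (of_real t powr (s + of_real (e i) - 1)))"
      by (simp only: set_lebesgue_integral_def c_eq)
    also have "\<dots> = c i / (s + of_real (e i))"
      by (simp only: set_integral_mult_right mellin_one_Ioc_01(2)[OF pos]) simp
    finally show "(LBINT t:{0<..1}. c i * of_real (t powr e i) * of_real t powr (s - 1)) = c i / (s + of_real (e i))" .
  qed
  have "(LBINT t:{0<..}. \<theta> t * of_real t powr (s - 1)) =
    (LBINT t:{0<..1}. \<theta> t * of_real t powr (s - 1)) + (LBINT t:{1<..}. \<theta> t * of_real t powr (s - 1))"
    unfolding U by (rule set_integral_Un) (use \<theta>1 theta_integrable_at_top in auto)
  also have "(\<lambda>t. \<theta> t * of_real t powr (s - 1)) = (\<lambda>t. (\<Sum>i\<le>N. c i * of_real (t powr e i) * of_real t powr (s - 1)) +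
      remainder N t * of_real t powr (s - 1))"
    by (simp add: remainder_def fun_eq_iff algebra_simps sum_distrib_left)
  also have "(LBINT t:{0<..1}. (\<Sum>i\<le>N. c i * of_real (t powr e i) * of_real t powr (s - 1)) +
      remainder N t * of_real t powr (s - 1)) = (\<Sum>i\<le>N. c i / (s + of_real (e i))) +
      (LBINT t:{0<..1}. remainder N t * of_real t powr (s - 1))"
  proof -
    have "set_integrable lborel {0<..1} (\<lambda>t. \<Sum>i\<le>N. c i * of_real (t powr e i) * of_real t powr (s - 1))"
      unfolding set_integrable_def scaleR_sum_right
      by (rule Bochner_Integration.integrable_sum) (use C(1) in \<open>simp add: set_integrable_def\<close>)
    moreover have "(LBINT t:{0<..1}. \<Sum>i\<le>N. c i * of_real (t powr e i) * of_real t powr (s - 1)) =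
        (\<Sum>i\<le>N. c i / (s + of_real (e i)))"
      unfolding C(2)[symmetric] unfolding set_lebesgue_integral_def scaleR_sum_right
      by (rule Bochner_Integration.integral_sum) (use C(1) in \<open>auto simp: set_integrable_def\<close>)
    ultimately show ?thesis using R by (simp only: set_integral_add)
  qed
  finally show ?thesis
    by (simp add: mellin_rest_def remainder_def algebra_simps sum_distrib_left)
qed

section \<open>Continuation and simple poles of the zeta function\<close>

definition zeta_local :: "nat \<Rightarrow> complex \<Rightarrow> complex" where
  "zeta_local N s = rGamma s * ((\<Sum>i\<le>N. c i / (s + of_real (e i))) + mellin_rest N s)"

lemma mellin_rest_analytic: "Re w > - e N \<Longrightarrow> mellin_rest N analytic_on {w}"
  by (rule holomorphic_on_imp_analytic_at[OF mellin_rest_holomorphic[of N]])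
     (auto simp: open_halfspace_Re_gt)

lemma zeta_local_meromorphic: "zeta_local N meromorphic_on {s. Re s > - e N}"
proof -
  have "mellin_rest N meromorphic_on {s. Re s > - e N}"
    by (intro analytic_on_imp_meromorphic_on)
       (simp add: analytic_on_open open_halfspace_Re_gt mellin_rest_holomorphic)
  moreover have "rGamma meromorphic_on {s. Re s > - e N}"
    by (intro analytic_on_imp_meromorphic_on analytic_rGamma)
  ultimately show ?thesis
    unfolding zeta_local_def[abs_def] by (intro meromorphic_on_mult meromorphic_on_add meromorphic_on_sum meromorphic_on_divide
        meromorphic_on_const meromorphic_on_id)
qed

text \<open>A pole of the Mellin transform at \<open>0\<close> is cancelled by the zero of \<^term>\<open>rGamma\<close>.\<close>

lemma zeta_local_simple_pole:
  assumes w: "Re w > - e N"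
  obtains k where "k analytic_on {w}" "eventually (\<lambda>s. (s - w) * zeta_local N s = k s) (at w)"
    "w = 0 \<longrightarrow> k w = 0"
proof -
  \<comment> \<open>If \<open>w = - e i\<close>, the factor \<open>s - w\<close> cancels the
    denominator and the constant \<open>c i\<close> remains; otherwise the quotient is analytic at
    \<open>w\<close>.\<close>
  define t where "t = (\<lambda>i s. if w + of_real (e i) = 0 then c i else (s - w) * (c i / (s + of_real (e i))))"
  define k where "k = (\<lambda>s. rGamma s * ((\<Sum>i\<le>N. t i s) + (s - w) * mellin_rest N s))"
  have t: "t i analytic_on {w}" for i
    by (cases "w + of_real (e i) = 0") (auto simp: t_def[abs_def] intro!: analytic_intros)
  have "k analytic_on {w}"
    unfolding k_def by (intro analytic_intros t mellin_rest_analytic w)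
  moreover have "eventually (\<lambda>s. (s - w) * zeta_local N s = k s) (at w)"
    using eventually_neq_at_within[of w w UNIV]
  proof eventually_elim
    case (elim s)
    have "(s - w) * (c i / (s + of_real (e i))) = t i s" for i
    proof (cases "w + of_real (e i) = 0")
      case True
      then have "s + of_real (e i) = s - w" by (simp add: add_eq_0_iff2)
      then show ?thesis using elim True by (simp add: t_def)
    qed (simp add: t_def)
    then have "(s - w) * (\<Sum>i\<le>N. c i / (s + of_real (e i))) = (\<Sum>i\<le>N. t i s)"
      by (simp add: sum_distrib_left)
    then show ?case
      by (simp only: zeta_local_def k_def distrib_left mult.left_commute)
  qed
  ultimately show ?thesis
    using that[of k] by (auto simp: k_def)
qed

text \<open>As \<open>e N\<close> is unbounded, the half-planes of the functions
  \<open>zeta_local N\<close> exhaust the plane; all these functions equal \<open>Z\<close> where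
  the Mellin integral converges, so they glue. The principal part at a point is read off from one
  whose half-plane contains it.\<close>

lemma zeta_meromorphic_continuation:
  assumes lim: "filterlim e at_top sequentially"
    and Z: "\<And>s. Re s > - e 0 \<Longrightarrow> Z s = 1 / Gamma s * (LBINT t:{0<..}. \<theta> t * of_real t powr (s - 1))"
  shows "\<exists>\<zeta>. \<zeta> meromorphic_on UNIV \<and> (\<forall>s. Re s > - e 0 \<longrightarrow> \<zeta> s = Z s) \<and>
    (\<forall>w. \<exists>h. h analytic_on {w} \<and> eventually (\<lambda>s. \<zeta> s = residue \<zeta> w / (s - w) + h s) (at w)) \<and>
    residue \<zeta> 0 = 0"
proof -
  have "\<exists>N. e N \<ge> real M" for M
    using lim unfolding filterlim_at_top eventually_sequentially by blast
  then obtain N where N: "\<And>M. e (N M) \<ge> real M" by metis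
  have eq: "zeta_local N s = Z s" if "Re s > - e 0" for N s
    using Z[OF that] mellin_eq[OF that, of N] by (simp add: zeta_local_def rGamma_inverse_Gamma field_simps)
  have mer_loc: "zeta_local (N M) meromorphic_on {s. Re s > - real M}" for M
    by (rule meromorphic_on_subset[OF zeta_local_meromorphic[of "N M"]]) (use N[of M] in auto)
  obtain \<zeta> where mer: "\<zeta> meromorphic_on UNIV" and \<zeta>: "\<And>s. Re s > - e 0 \<Longrightarrow> \<zeta> s = Z s"
    and loc: "\<And>M w. Re w > - real M \<Longrightarrow> eventually (\<lambda>s. \<zeta> s = zeta_local (N M) s) (at w)"
    using meromorphic_on_union_of_half_planes[of "\<lambda>M. zeta_local (N M)" "- e 0" Z, OF mer_loc eq] by blast
  have pole: "(\<exists>h. h analytic_on {w} \<and> eventually (\<lambda>s. \<zeta> s = residue \<zeta> w / (s - w) + h s) (at w)) \<and>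
      (w = 0 \<longrightarrow> residue \<zeta> w = 0)" for w
  proof -
    define M where "M = nat \<lceil>- Re w\<rceil> + 1"
    have M: "Re w > - real M" unfolding M_def by linarith
    then have "Re w > - e (N M)" using N[of M] by linarith
    then obtain k where k: "k analytic_on {w}"
      "eventually (\<lambda>s. (s - w) * zeta_local (N M) s = k s) (at w)" "w = 0 \<longrightarrow> k w = 0"
      by (rule zeta_local_simple_pole)
    from loc[OF M] k(2) have "eventually (\<lambda>s. (s - w) * \<zeta> s = k s) (at w)"
      by eventually_elim auto
    then obtain h where "h analytic_on {w}" "eventually (\<lambda>s. \<zeta> s = k w / (s - w) + h s) (at w)"
      "residue \<zeta> w = k w"
      by (rule pole_order_le_1_laurent[OF k(1)])
    with k(3) show ?thesis by auto
  qed
  show ?thesis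
  proof (rule exI[of _ \<zeta>], intro conjI allI impI)
    show "\<exists>h. h analytic_on {w} \<and> eventually (\<lambda>s. \<zeta> s = residue \<zeta> w / (s - w) + h s) (at w)" for w
      by (rule conjunct1[OF pole])
  qed (use mer \<zeta> pole[of 0] in simp_all)
qed

end

subsection \<open>Expansion of the powers\<close>

lemma has_sum_finite_sum:
  fixes f :: "'b \<Rightarrow> 'i \<Rightarrow> 'c :: topological_comm_monoid_add"
  assumes "finite T" "\<And>l. l \<in> T \<Longrightarrow> (f l has_sum S l) I"
  shows "((\<lambda>k. \<Sum>l\<in>T. f l k) has_sum (\<Sum>l\<in>T. S l)) I"
  using assms by (induction rule: finite_induct) (auto intro: has_sum_add)

text \<open>Weierstrass's theorem along the net of finite subsets of \<open>I\<close>: the M-test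
  gives uniform convergence on closed discs, hence a holomorphic limit and termwise differentiation.
  The latter evaluates the derivative of the tail at \<open>0\<close> later on.\<close>

lemma infsum_holomorphic:
  fixes f :: "'i \<Rightarrow> complex \<Rightarrow> complex"
  assumes S: "open S" and f: "\<And>k. k \<in> I \<Longrightarrow> f k holomorphic_on S"
    and bound: "\<And>x r. r > 0 \<Longrightarrow> cball x r \<subseteq> S \<Longrightarrow>
        \<exists>M. M summable_on I \<and> (\<forall>k\<in>I. \<forall>s\<in>cball x r. norm (f k s) \<le> M k)"
  shows "(\<lambda>s. \<Sum>\<^sub>\<infinity>k\<in>I. f k s) holomorphic_on S"
    and "\<And>s. s \<in> S \<Longrightarrow> ((\<lambda>k. deriv (f k) s) has_sum deriv (\<lambda>s. \<Sum>\<^sub>\<infinity>k\<in>I. f k s) s) I"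
    and "\<And>s. s \<in> S \<Longrightarrow> (\<lambda>k. f k s) summable_on I"
proof -
  define F where "F = (\<lambda>s. \<Sum>\<^sub>\<infinity>k\<in>I. f k s)"
  have main: "(F has_field_derivative deriv F s) (at s) \<and> ((\<lambda>k. deriv (f k) s) has_sum deriv F s) I
      \<and> (\<lambda>k. f k s) summable_on I" if s: "s \<in> S" for s
  proof -
    obtain r where r: "r > 0" "cball s r \<subseteq> S"
      using S s open_contains_cball by blast
    obtain M where M: "M summable_on I" "\<And>k x. k \<in> I \<Longrightarrow> x \<in> cball s r \<Longrightarrow> norm (f k x) \<le> M k"
      using bound[OF r] by blast
    have "uniform_limit (cball s r) (\<lambda>X y. \<Sum>k\<in>X. f k y) F (finite_subsets_at_top I)"
      unfolding F_def by (rule Weierstrass_m_test_general[OF M(2,1)])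
    moreover have "eventually (\<lambda>X. continuous_on (cball s r) (\<lambda>y. \<Sum>k\<in>X. f k y) \<and>
        (\<forall>w\<in>ball s r. ((\<lambda>y. \<Sum>k\<in>X. f k y) has_field_derivative (\<Sum>k\<in>X. deriv (f k) w)) (at w)))
        (finite_subsets_at_top I)"
    proof (rule eventually_finite_subsets_at_top_weakI)
      fix X assume X: "finite X" "X \<subseteq> I"
      have "continuous_on (cball s r) (f k)" if "k \<in> X" for k
        using X r f that by (meson holomorphic_on_imp_continuous_on holomorphic_on_subset subsetD)
      moreover have "(f k has_field_derivative deriv (f k) w) (at w)" if "k \<in> X" "w \<in> ball s r" for k w
      proof -
        have "w \<in> S" using that(2) r(2) ball_subset_cball by blast
        moreover have "f k holomorphic_on S" using X that f by blast
        ultimately show ?thesis using S holomorphic_derivI by blast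
      qed
      ultimately show "continuous_on (cball s r) (\<lambda>y. \<Sum>k\<in>X. f k y) \<and>
        (\<forall>w\<in>ball s r. ((\<lambda>y. \<Sum>k\<in>X. f k y) has_field_derivative (\<Sum>k\<in>X. deriv (f k) w)) (at w))"
        by (auto intro!: continuous_intros derivative_intros)
    qed
    ultimately obtain g' where g': "\<And>w. w \<in> ball s r \<Longrightarrow> (F has_field_derivative (g' w)) (at w) \<and>
        ((\<lambda>X. \<Sum>k\<in>X. deriv (f k) w) \<longlongrightarrow> g' w) (finite_subsets_at_top I)"
      using has_complex_derivative_uniform_limit[of s r "\<lambda>X y. \<Sum>k\<in>X. f k y"
          "\<lambda>X w. \<Sum>k\<in>X. deriv (f k) w" "finite_subsets_at_top I" F] r(1)
      by (auto simp: finite_subsets_at_top_neq_bot)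
    moreover have "deriv F s = g' s"
      using g'[of s] r(1) by (auto intro: DERIV_imp_deriv)
    moreover have "(\<lambda>k. f k s) summable_on I"
      by (rule abs_summable_summable[OF Infinite_Sum.abs_summable_on_comparison_test'[OF M(1)]]) (use M(2)[of _ s] r in auto)
    ultimately show ?thesis
      using r(1) by (auto simp: has_sum_def)
  qed
  show "F holomorphic_on S"
    using main S by (auto simp: holomorphic_on_open)
  show "\<And>s. s \<in> S \<Longrightarrow> ((\<lambda>k. deriv (f k) s) has_sum deriv F s) I"
    "\<And>s. s \<in> S \<Longrightarrow> (\<lambda>k. f k s) summable_on I"
    using main by auto
qed

section \<open>Truncating the exponential of a polynomial\<close>

lemma poly_truncation_bound:
  fixes Q :: "complex poly"
  assumes "W \<ge> 0"
  obtains C where "C \<ge> 0" "\<And>w. norm w \<le> W \<Longrightarrow> norm (poly Q w - (\<Sum>l\<le>M. coeff Q l * w ^ l)) \<le> C * norm w ^ (M + 1)"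
proof
  \<comment> \<open>The maximum lets the range split at \<open>M\<close> even when the degree is
    smaller.\<close>
  define D where "D = max (degree Q) M"
  define C where "C = (\<Sum>l\<in>{M<..D}. norm (coeff Q l) * W ^ (l - (M + 1)))"
  show "C \<ge> 0" unfolding C_def using assms by (auto intro!: sum_nonneg)
  fix w :: complex assume w: "norm w \<le> W"
  have "poly Q w = (\<Sum>l\<le>D. coeff Q l * w ^ l)"
    unfolding poly_altdef by (rule sum.mono_neutral_left) (auto simp: D_def coeff_eq_0)
  also have "{..D} = {..M} \<union> {M<..D}" by (auto simp: D_def)
  finally have "poly Q w - (\<Sum>l\<le>M. coeff Q l * w ^ l) = (\<Sum>l\<in>{M<..D}. coeff Q l * w ^ l)"
    by (subst (asm) sum.union_disjoint) auto
  also have "norm \<dots> \<le> (\<Sum>l\<in>{M<..D}. norm (coeff Q l) * (W ^ (l - (M + 1)) * norm w ^ (M + 1)))"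
  proof (rule order_trans[OF norm_sum], rule sum_mono)
    fix l assume l: "l \<in> {M<..D}"
    then have "norm w ^ l = norm w ^ (l - (M + 1)) * norm w ^ (M + 1)"
      by (simp flip: power_add power_Suc)
    also have "\<dots> \<le> W ^ (l - (M + 1)) * norm w ^ (M + 1)"
      by (intro mult_right_mono power_mono w) auto
    finally show "norm (coeff Q l * w ^ l) \<le> norm (coeff Q l) * (W ^ (l - (M + 1)) * norm w ^ (M + 1))"
      by (simp add: norm_mult norm_power mult_left_mono del: power_Suc)
  qed
  finally show "norm (poly Q w - (\<Sum>l\<le>M. coeff Q l * w ^ l)) \<le> C * norm w ^ (M + 1)"
    by (simp add: C_def sum_distrib_right mult.assoc)
qed

text \<open>
  The coefficient of \<open>w\<^sup>l\<close> in \<open>exp (s P(w))\<close>, with the exponential series cut off at order \<open>M + 2\<close>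
  rather than \<open>M\<close> so that the terms of degree at most \<open>2\<close> in \<open>s\<close> are always present.
\<close>

definition exp_poly_coeff :: "complex poly \<Rightarrow> nat \<Rightarrow> nat \<Rightarrow> complex \<Rightarrow> complex" where
  "exp_poly_coeff P M l s = (\<Sum>q\<le>M + 2. s ^ q / fact q * coeff (P ^ q) l)"

text \<open>Two errors add up: \<open>C1\<close> from cutting off the exponential series and
  \<open>C2\<close> from dropping the degrees above \<open>M\<close> in each \<open>P ^ q\<close>.
  Since \<open>P\<close> vanishes at \<open>0\<close>, the first error is even of order
  \<open>M + 3\<close> in \<open>w\<close>.\<close>

lemma exp_poly_bound:
  fixes P :: "complex poly"
  assumes P0: "coeff P 0 = 0" and B: "B \<ge> 0" and W: "W \<ge> 0"
  obtains C where "C \<ge> 0" "\<And>s w. norm s \<le> B \<Longrightarrow> norm w \<le> W \<Longrightarrow>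
    norm (exp (s * poly P w) - (\<Sum>l\<le>M. exp_poly_coeff P M l s * w ^ l)) \<le> C * norm w ^ (M + 1)"
proof -
  obtain K where K: "K \<ge> 0" "\<And>w. norm w \<le> W \<Longrightarrow> norm (poly P w) \<le> K * norm w"
    using poly_truncation_bound[OF W, where Q = P and M = 0] P0 by auto
  have "\<forall>q. \<exists>C. C \<ge> 0 \<and> (\<forall>w. norm w \<le> W \<longrightarrow>
      norm (poly (P ^ q) w - (\<Sum>l\<le>M. coeff (P ^ q) l * w ^ l)) \<le> C * norm w ^ (M + 1))"
    using poly_truncation_bound[OF W] by metis
  then obtain c where c: "\<And>q. c q \<ge> 0" "\<And>q w. norm w \<le> W \<Longrightarrow>
      norm (poly (P ^ q) w - (\<Sum>l\<le>M. coeff (P ^ q) l * w ^ l)) \<le> c q * norm w ^ (M + 1)"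
    by metis
  define C1 where "C1 = exp (B * (K * W)) * ((B * K) ^ (M + 3) * W ^ 2) / fact (M + 2)"
  define C2 where "C2 = (\<Sum>q\<le>M + 2. B ^ q / fact q * c q)"
  show ?thesis
  proof (rule that[of "C1 + C2"])
    show "C1 + C2 \<ge> 0" using B K W c by (auto simp: C1_def C2_def intro!: add_nonneg_nonneg sum_nonneg)
    fix s w :: complex assume s: "norm s \<le> B" and w: "norm w \<le> W"
    have sP: "norm (s * poly P w) \<le> B * (K * norm w)"
      unfolding norm_mult using s K(2)[OF w] B by (intro mult_mono) auto
    have "norm (exp (s * poly P w) - (\<Sum>q\<le>M + 2. (s * poly P w) ^ q / fact q)) \<le>
        exp (norm (s * poly P w)) * norm (s * poly P w) ^ (M + 3) / fact (M + 2)"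
      using Taylor_exp_field[of "s * poly P w" "M + 2"] by (simp add: numeral_eq_Suc)
    also have "\<dots> \<le> exp (B * (K * W)) * (B * (K * norm w)) ^ (M + 3) / fact (M + 2)"
    proof (intro divide_right_mono mult_mono power_mono sP)
      have "B * (K * norm w) \<le> B * (K * W)" using B K w by (intro mult_left_mono) auto
      then show "exp (norm (s * poly P w)) \<le> exp (B * (K * W))" using sP by simp
    qed auto
    \<comment> \<open>Two of the \<open>M + 3\<close> powers of \<open>norm w\<close> are surplus
      and are absorbed by \<open>W ^ 2\<close> in \<open>C1\<close>.\<close>
    also have "(B * (K * norm w)) ^ (M + 3) = (B * K) ^ (M + 3) * norm w ^ 2 * norm w ^ (M + 1)"
      by (simp add: power_mult_distrib power_add numeral_eq_Suc)
    also have "exp (B * (K * W)) * ((B * K) ^ (M + 3) * norm w ^ 2 * norm w ^ (M + 1)) / fact (M + 2) \<le>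
        exp (B * (K * W)) * ((B * K) ^ (M + 3) * W ^ 2 * norm w ^ (M + 1)) / fact (M + 2)"
      using B K w by (intro divide_right_mono mult_left_mono mult_right_mono power_mono) auto
    also have "\<dots> = C1 * norm w ^ (M + 1)" by (simp add: C1_def)
    finally have 1: "norm (exp (s * poly P w) - (\<Sum>q\<le>M + 2. (s * poly P w) ^ q / fact q)) \<le> C1 * norm w ^ (M + 1)" .
    have "(\<Sum>l\<le>M. exp_poly_coeff P M l s * w ^ l) = (\<Sum>q\<le>M + 2. s ^ q / fact q * (\<Sum>l\<le>M. coeff (P ^ q) l * w ^ l))"
      unfolding exp_poly_coeff_def sum_distrib_right sum_distrib_left
      by (subst sum.swap) (simp only: mult.assoc)
    then have "(\<Sum>q\<le>M + 2. (s * poly P w) ^ q / fact q) - (\<Sum>l\<le>M. exp_poly_coeff P M l s * w ^ l) =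
        (\<Sum>q\<le>M + 2. s ^ q / fact q * (poly (P ^ q) w - (\<Sum>l\<le>M. coeff (P ^ q) l * w ^ l)))"
      by (simp only: sum_subtractf[symmetric] right_diff_distrib poly_power power_mult_distrib) simp
    also have "norm \<dots> \<le> (\<Sum>q\<le>M + 2. B ^ q / fact q * (c q * norm w ^ (M + 1)))"
    proof (rule order_trans[OF norm_sum], rule sum_mono)
      fix q
      have "norm (s ^ q / fact q) \<le> B ^ q / fact q"
        using s by (simp add: norm_divide norm_power divide_right_mono power_mono)
      then show "norm (s ^ q / fact q * (poly (P ^ q) w - (\<Sum>l\<le>M. coeff (P ^ q) l * w ^ l)))
          \<le> B ^ q / fact q * (c q * norm w ^ (M + 1))"
        unfolding norm_mult[of "s ^ q / fact q"] using c(2)[OF w, of q] B by (intro mult_mono) auto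
    qed
    also have "\<dots> = C2 * norm w ^ (M + 1)" by (simp only: C2_def sum_distrib_right mult.assoc)
    finally have 2: "norm ((\<Sum>q\<le>M + 2. (s * poly P w) ^ q / fact q) - (\<Sum>l\<le>M. exp_poly_coeff P M l s * w ^ l))
        \<le> C2 * norm w ^ (M + 1)" .
    have "norm (exp (s * poly P w) - (\<Sum>l\<le>M. exp_poly_coeff P M l s * w ^ l)) \<le> C1 * norm w ^ (M + 1) + C2 * norm w ^ (M + 1)"
      using norm_triangle_mono[OF 1 2] by simp
    then show "norm (exp (s * poly P w) - (\<Sum>l\<le>M. exp_poly_coeff P M l s * w ^ l)) \<le> (C1 + C2) * norm w ^ (M + 1)"
      by (simp add: algebra_simps)
  qed
qed

section \<open>Sequences of finite order\<close>

locale order_sequence =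
  fixes I :: "'i set" and lam :: "'i \<Rightarrow> complex" and \<mu> :: real
  assumes nonzero: "\<And>k. k \<in> I \<Longrightarrow> lam k \<noteq> 0" and mu_pos: "\<mu> > 0"
    and summable: "\<And>x. x > \<mu> \<Longrightarrow> (\<lambda>k. cmod (lam k) powr (- x)) summable_on I"
begin

lemma sum_le_infsum:
  assumes "x > \<mu>" "finite F" "F \<subseteq> I"
  shows "(\<Sum>k\<in>F. cmod (lam k) powr (- x)) \<le> (\<Sum>\<^sub>\<infinity>k\<in>I. cmod (lam k) powr (- x))"
  by (rule finite_sum_le_infsum[OF summable]) (use assms in auto)

lemma inverse_bounded:
  obtains W where "W > 0" "\<And>k. k \<in> I \<Longrightarrow> norm (inverse (lam k)) \<le> W"
proof
  define x where "x = \<mu> + 1"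
  have x: "x > \<mu>" "x > 0" using mu_pos by (auto simp: x_def)
  define S where "S = (\<Sum>\<^sub>\<infinity>k\<in>I. cmod (lam k) powr (- x))"
  have "S \<ge> 0" unfolding S_def by (rule infsum_nonneg) auto
  then show "(S + 1) powr (1 / x) > 0" by simp
  fix k assume k: "k \<in> I"
  have "cmod (lam k) powr (- x) \<le> S + 1"
    using sum_le_infsum[of x "{k}"] k x by (simp add: S_def)
  then have "(cmod (lam k) powr (- x)) powr (1 / x) \<le> (S + 1) powr (1 / x)"
    using x by (intro powr_mono2) auto
  also have "(cmod (lam k) powr (- x)) powr (1 / x) = norm (inverse (lam k))"
    using x nonzero[OF k] powr_minus[of "cmod (lam k)" 1] by (simp only: powr_powr) (simp add: norm_inverse)
  finally show "norm (inverse (lam k)) \<le> (S + 1) powr (1 / x)" .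
qed

text \<open>Infinitely many terms of modulus at most \<open>B\<close> would each contribute at least
  \<open>B powr (- x)\<close> to a convergent sum.\<close>

lemma finite_norm_le: "finite {k \<in> I. cmod (lam k) \<le> B}"
proof (rule ccontr)
  define x where "x = \<mu> + 1"
  have x: "x > \<mu>" "x > 0" using mu_pos by (auto simp: x_def)
  define S where "S = (\<Sum>\<^sub>\<infinity>k\<in>I. cmod (lam k) powr (- x))"
  assume inf: "infinite {k \<in> I. cmod (lam k) \<le> B}"
  then obtain k where "k \<in> I" "cmod (lam k) \<le> B" using not_finite_existsD by auto
  with nonzero[of k] have B: "B > 0" by (smt (verit) zero_less_norm_iff)
  obtain N :: nat where N: "real N * B powr (- x) > S"
    using reals_Archimedean3[of "B powr (- x)"] B by auto
  obtain F where F: "F \<subseteq> {k \<in> I. cmod (lam k) \<le> B}" "finite F" "card F = N"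
    using infinite_arbitrarily_large[OF inf] by metis
  have "real N * B powr (- x) = (\<Sum>k\<in>F. B powr (- x))" using F by simp
  also have "\<dots> \<le> (\<Sum>k\<in>F. cmod (lam k) powr (- x))"
    by (rule sum_mono, rule powr_mono2') (use F x nonzero in auto)
  also have "\<dots> \<le> S" unfolding S_def by (rule sum_le_infsum) (use F x in auto)
  finally show False using N by simp
qed

lemma principal_powers_eq: "k \<in> I \<Longrightarrow> principal_powers lam k s = exp (- (s * Ln (lam k)))"
  using nonzero by (simp add: principal_powers_def powr_def)

text \<open>The principal argument is at most \<open>pi\<close> in modulus, so a complex exponent
  costs only a factor that does not depend on \<open>k\<close>.\<close>

lemma norm_exp_Ln_le:
  assumes "k \<in> I"
  shows "norm (exp (- (s * Ln (lam k)))) \<le> exp (pi * \<bar>Im s\<bar>) * cmod (lam k) powr (- Re s)"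
proof -
  have "\<bar>Im (Ln (lam k))\<bar> \<le> pi"
    using Im_Ln_le_pi[of "lam k"] mpi_less_Im_Ln[of "lam k"] nonzero[OF assms] by simp
  then have "\<bar>Im s * Im (Ln (lam k))\<bar> \<le> pi * \<bar>Im s\<bar>"
    unfolding abs_mult mult.commute[of pi] by (intro mult_left_mono) auto
  then have "Im s * Im (Ln (lam k)) \<le> pi * \<bar>Im s\<bar>" by linarith
  moreover have "norm (exp (- (s * Ln (lam k)))) = exp (Im s * Im (Ln (lam k))) * cmod (lam k) powr (- Re s)"
    using nonzero[OF assms] by (simp add: powr_def exp_add[symmetric])
  ultimately show ?thesis by (simp add: mult_right_mono)
qed

lemma principal_powers_summable:
  assumes "Re s > \<mu>"
  shows "(\<lambda>k. principal_powers lam k s) summable_on I"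
proof (rule abs_summable_summable[OF Infinite_Sum.abs_summable_on_comparison_test'])
  show "(\<lambda>k. exp (pi * \<bar>Im s\<bar>) * cmod (lam k) powr (- Re s)) summable_on I"
    by (intro summable_on_cmult_right summable assms)
qed (use norm_exp_Ln_le in \<open>auto simp: principal_powers_eq\<close>)

text \<open>The decay of \<open>r\<close> improves that of the power of \<open>lam k\<close> by
  \<open>M + 1\<close>, so the terms are summable once \<open>n Re s + M + 1\<close> exceeds
  \<open>\<mu>\<close>, with a common majorant on each closed disc.\<close>

lemma holomorphic_tail:
  fixes r :: "'i \<Rightarrow> complex \<Rightarrow> complex" and n M :: nat
  assumes r: "\<And>k. k \<in> I \<Longrightarrow> r k holomorphic_on UNIV"
    and r_bound: "\<And>B. B \<ge> 0 \<Longrightarrow> \<exists>C\<ge>0. \<forall>k\<in>I. \<forall>s. norm s \<le> B \<longrightarrow> norm (r k s) \<le> C * norm (inverse (lam k)) ^ (M + 1)"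
    and S: "S = {s. real n * Re s > \<mu> - real M - 1}"
  defines "f \<equiv> \<lambda>k s. exp (- (of_nat n * s * Ln (lam k))) * r k s"
  shows "(\<lambda>s. \<Sum>\<^sub>\<infinity>k\<in>I. f k s) holomorphic_on S"
    and "\<And>s. s \<in> S \<Longrightarrow> ((\<lambda>k. deriv (f k) s) has_sum deriv (\<lambda>s. \<Sum>\<^sub>\<infinity>k\<in>I. f k s) s) I"
    and "\<And>s. s \<in> S \<Longrightarrow> (\<lambda>k. f k s) summable_on I"
proof -
  have open_S: "open S"
    unfolding S by (intro open_Collect_less continuous_intros)
  have hol: "f k holomorphic_on S" if "k \<in> I" for k
    unfolding f_def by (intro holomorphic_intros holomorphic_on_subset[OF r[OF that]]) auto
  have bound: "\<exists>N. N summable_on I \<and> (\<forall>k\<in>I. \<forall>s\<in>cball x \<rho>. norm (f k s) \<le> N k)"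
    if \<rho>: "\<rho> > 0" "cball x \<rho> \<subseteq> S" for x \<rho>
  proof -
    define B where "B = norm x + \<rho>"
    have B: "B \<ge> 0" "\<And>s. s \<in> cball x \<rho> \<Longrightarrow> norm s \<le> B"
    proof -
      show "B \<ge> 0" using \<rho> by (auto simp: B_def)
      fix s assume "s \<in> cball x \<rho>"
      then have "norm (s - x) \<le> \<rho>" by (simp add: dist_norm norm_minus_commute)
      then show "norm s \<le> B" unfolding B_def using norm_triangle_ineq[of x "s - x"] by simp
    qed
    obtain C where C: "C \<ge> 0" "\<And>k s. k \<in> I \<Longrightarrow> norm s \<le> B \<Longrightarrow> norm (r k s) \<le> C * norm (inverse (lam k)) ^ (M + 1)"
      using r_bound[OF B(1)] by blast
    \<comment> \<open>\<open>\<tau>\<close> is the exponent of decay of the terms and exceeds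
      \<open>\<mu>\<close> exactly on \<open>S\<close>. On the disc it lies between its values at
      the leftmost and rightmost points \<open>s1\<close> and \<open>s2\<close>; the majorant
      \<open>N\<close> contains both powers because \<open>cmod (lam k)\<close> may be below or
      above \<open>1\<close>.\<close>
    define \<tau> where "\<tau> = (\<lambda>s. real n * Re s + real (M + 1))"
    define s1 where "s1 = x - of_real \<rho>"
    define s2 where "s2 = x + of_real \<rho>"
    have "s1 \<in> S" "s2 \<in> S"
      using \<rho> by (auto simp: s1_def s2_def dist_norm intro!: subsetD[OF \<rho>(2)])
    then have \<tau>: "\<tau> s1 > \<mu>" "\<tau> s2 > \<mu>"
      by (auto simp: S \<tau>_def)
    define N where "N = (\<lambda>k. (exp (pi * (real n * B)) * C) * (cmod (lam k) powr (- \<tau> s1) + cmod (lam k) powr (- \<tau> s2)))"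
    have "N summable_on I"
      unfolding N_def by (intro summable_on_cmult_right summable_on_add summable \<tau>)
    moreover have "norm (f k s) \<le> N k" if k: "k \<in> I" and s: "s \<in> cball x \<rho>" for k s
    proof -
      have "\<bar>Re (s - x)\<bar> \<le> norm (s - x)" by (rule abs_Re_le_cmod)
      also have "\<dots> \<le> \<rho>" using s by (simp add: dist_norm norm_minus_commute)
      finally have "Re s1 \<le> Re s" "Re s \<le> Re s2" by (auto simp: s1_def s2_def)
      then have \<tau>_le: "\<tau> s1 \<le> \<tau> s" "\<tau> s \<le> \<tau> s2" by (auto simp: \<tau>_def intro!: mult_left_mono)
      have pos: "cmod (lam k) > 0" using nonzero[OF k] by simp
      have le: "cmod (lam k) powr (- \<tau> s) \<le> cmod (lam k) powr (- \<tau> s1) + cmod (lam k) powr (- \<tau> s2)"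
      proof (cases "cmod (lam k) \<ge> 1")
        case True
        then have "cmod (lam k) powr (- \<tau> s) \<le> cmod (lam k) powr (- \<tau> s1)"
          using \<tau>_le by (intro powr_mono) auto
        then show ?thesis by (simp add: add_increasing2)
      next
        case False
        then have "cmod (lam k) powr (- \<tau> s) \<le> cmod (lam k) powr (- \<tau> s2)"
          using \<tau>_le pos by (intro powr_mono') auto
        then show ?thesis by (simp add: add_increasing)
      qed
      have "norm (f k s) = norm (exp (- (of_nat n * s * Ln (lam k)))) * norm (r k s)"
        by (simp add: f_def norm_mult)
      also have "\<dots> \<le> (exp (pi * (real n * B)) * cmod (lam k) powr (- (real n * Re s))) *
          (C * norm (inverse (lam k)) ^ (M + 1))"
      proof (intro mult_mono C k B s)
        have "\<bar>Im (of_nat n * s)\<bar> \<le> real n * B"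
          using B(2)[OF s] abs_Im_le_cmod[of s] by (simp add: abs_mult mult_left_mono)
        then have "exp (pi * \<bar>Im (of_nat n * s)\<bar>) \<le> exp (pi * (real n * B))" by simp
        then show "norm (exp (- (of_nat n * s * Ln (lam k)))) \<le> exp (pi * (real n * B)) * cmod (lam k) powr (- (real n * Re s))"
          using norm_exp_Ln_le[OF k, of "of_nat n * s"]
          by (simp add: mult_right_mono order_trans[OF _ mult_right_mono])
      qed auto
      also have "norm (inverse (lam k)) ^ (M + 1) = cmod (lam k) powr (- real (M + 1))"
        using powr_realpow[OF pos, of "M + 1"] by (simp only: powr_minus norm_inverse power_inverse)
      also have "exp (pi * (real n * B)) * cmod (lam k) powr (- (real n * Re s)) * (C * cmod (lam k) powr (- real (M + 1)))
          = (exp (pi * (real n * B)) * C) * cmod (lam k) powr (- \<tau> s)"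
        by (simp add: \<tau>_def powr_add[symmetric] algebra_simps)
      also have "\<dots> \<le> N k"
        unfolding N_def using C(1) by (intro mult_left_mono le) auto
      finally show ?thesis .
    qed
    ultimately show ?thesis by blast
  qed
  show "(\<lambda>s. \<Sum>\<^sub>\<infinity>k\<in>I. f k s) holomorphic_on S"
    by (rule infsum_holomorphic(1)[OF open_S hol bound])
  show "\<And>s. s \<in> S \<Longrightarrow> ((\<lambda>k. deriv (f k) s) has_sum deriv (\<lambda>s. \<Sum>\<^sub>\<infinity>k\<in>I. f k s) s) I"
    by (rule infsum_holomorphic(2)[OF open_S hol bound])
  show "\<And>s. s \<in> S \<Longrightarrow> (\<lambda>k. f k s) summable_on I"
    by (rule infsum_holomorphic(3)[OF open_S hol bound])
qed

end

section \<open>Zeta functions of shifted sequences and their products\<close>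

text \<open>
  The single sequences are the case \<open>n = 1\<close>. Only the asymptotics of \<open>A\<close> matters, so that the
  arbitrary logarithms of finitely many terms need no separate treatment.
\<close>

locale shifted_sequence = order_sequence +
  fixes n :: nat and A :: "'i \<Rightarrow> complex" and a :: "nat \<Rightarrow> complex"
  assumes n: "n \<ge> 1"
    and A: "\<And>M. \<exists>C. \<forall>k\<in>I. norm (A k - (\<Sum>l=1..M. a l * inverse (lam k) ^ l)) \<le> C * norm (inverse (lam k)) ^ (M + 1)"
begin

text \<open>When \<open>A k\<close> is \<open>n Ln (lam k)\<close> minus the sum of the chosen
  logarithms of the \<open>lam k - z j\<close>, this is the power with exponent \<open>-s\<close> of
  the product of the shifted terms, in the chosen branches.\<close>

definition powers :: "'i \<Rightarrow> complex \<Rightarrow> complex" where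
  "powers k s = exp (s * (A k - of_nat n * Ln (lam k)))"

definition P :: "nat \<Rightarrow> complex poly" where
  "P M = (\<Sum>l=1..M. monom (a l) l)"

lemma coeff_P: "coeff (P M) l = (if 1 \<le> l \<and> l \<le> M then a l else 0)"
  by (simp add: P_def coeff_sum coeff_monom)

lemma poly_P: "poly (P M) w = (\<Sum>l=1..M. a l * w ^ l)"
  by (simp add: P_def poly_sum poly_monom)

abbreviation p :: "nat \<Rightarrow> nat \<Rightarrow> complex \<Rightarrow> complex" where
  "p M \<equiv> exp_poly_coeff (P M) M"

definition r :: "nat \<Rightarrow> 'i \<Rightarrow> complex \<Rightarrow> complex" where
  "r M k s = exp (s * A k) - (\<Sum>l\<le>M. p M l s * inverse (lam k) ^ l)"

lemma p_holomorphic: "p M l holomorphic_on S"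
  unfolding exp_poly_coeff_def[abs_def] by (intro holomorphic_intros) auto

lemma r_holomorphic: "r M k holomorphic_on S"
  unfolding r_def[abs_def] by (intro holomorphic_intros p_holomorphic)

text \<open>Write \<open>A k = poly (P M) w + d\<close> with \<open>w = inverse (lam k)\<close> and
  \<open>d\<close> of order \<open>M + 1\<close>. Then \<open>exp (s * A k)\<close> differs from the
  exponential of the polynomial by the factor \<open>exp (s * d)\<close>, whose distance from
  \<open>1\<close> is of the same order, and \<open>exp_poly_bound\<close> treats the rest.\<close>

lemma r_bound:
  assumes B: "B \<ge> 0"
  shows "\<exists>C\<ge>0. \<forall>k\<in>I. \<forall>s. norm s \<le> B \<longrightarrow> norm (r M k s) \<le> C * norm (inverse (lam k)) ^ (M + 1)"
proof -
  obtain W where W: "W > 0" "\<And>k. k \<in> I \<Longrightarrow> norm (inverse (lam k)) \<le> W"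
    using inverse_bounded by blast
  obtain C0 where C0: "\<And>k. k \<in> I \<Longrightarrow> norm (A k - poly (P M) (inverse (lam k))) \<le> C0 * norm (inverse (lam k)) ^ (M + 1)"
    using A[of M] unfolding poly_P by blast
  define C1 where "C1 = max C0 0"
  have C1: "norm (A k - poly (P M) (inverse (lam k))) \<le> C1 * norm (inverse (lam k)) ^ (M + 1)" if "k \<in> I" for k
    by (rule order_trans[OF C0[OF that]], rule mult_right_mono) (auto simp: C1_def)
  obtain C2 where C2: "C2 \<ge> 0" "\<And>s w. norm s \<le> B \<Longrightarrow> norm w \<le> W \<Longrightarrow>
    norm (exp (s * poly (P M) w) - (\<Sum>l\<le>M. p M l s * w ^ l)) \<le> C2 * norm w ^ (M + 1)"
    using exp_poly_bound[OF _ B, of "P M" W M] W(1) by (auto simp: coeff_P)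
  obtain K where K: "K \<ge> 0" "\<And>w. norm w \<le> W \<Longrightarrow> norm (poly (P M) w - (\<Sum>l\<le>0. coeff (P M) l * w ^ l)) \<le> K * norm w ^ (0 + 1)"
    using poly_truncation_bound[of W] W(1) by (metis less_imp_le)
  define E where "E = exp (B * (K * W)) * (B * C1 * exp (B * (C1 * W ^ (M + 1))))"
  have C1_0: "C1 \<ge> 0" by (simp add: C1_def)
  have E0: "E \<ge> 0" using B W C1_0 by (simp add: E_def)
  show ?thesis
  proof (intro exI[of _ "E + C2"] conjI ballI allI impI)
    show "E + C2 \<ge> 0" using E0 C2 by simp
    fix k and s :: complex assume k: "k \<in> I" and s: "norm s \<le> B"
    define w where "w = inverse (lam k)"
    have w: "norm w \<le> W" using W(2)[OF k] by (simp add: w_def)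
    define d where "d = A k - poly (P M) w"
    have d: "norm d \<le> C1 * norm w ^ (M + 1)" using C1[OF k] by (simp add: d_def w_def)
    also have "\<dots> \<le> C1 * W ^ (M + 1)" using C1_0 w by (intro mult_left_mono power_mono) auto
    finally have d': "norm d \<le> C1 * W ^ (M + 1)" .
    have sP: "norm (s * poly (P M) w) \<le> B * (K * W)"
    proof -
      have "norm (poly (P M) w) \<le> K * norm w" using K(2)[OF w] by (simp add: coeff_P)
      also have "\<dots> \<le> K * W" using K(1) w by (intro mult_left_mono) auto
      finally show ?thesis unfolding norm_mult using s B by (intro mult_mono) auto
    qed
    have "norm (exp (s * poly (P M) w)) \<le> exp (B * (K * W))"
      using sP norm_exp[of "s * poly (P M) w"] by (meson exp_le_cancel_iff order_trans)
    moreover have "norm (exp (s * d) - 1) \<le> (B * C1 * exp (B * (C1 * W ^ (M + 1)))) * norm w ^ (M + 1)"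
    proof -
      have "norm (exp (s * d) - 1) \<le> norm (s * d) * exp (norm (s * d))"
        by (rule norm_exp_minus_1_le)
      also have "\<dots> \<le> (B * (C1 * norm w ^ (M + 1))) * exp (B * (C1 * W ^ (M + 1)))"
      proof (rule mult_mono)
        show "norm (s * d) \<le> B * (C1 * norm w ^ (M + 1))"
          unfolding norm_mult using s d B by (intro mult_mono) auto
        have "norm (s * d) \<le> B * (C1 * W ^ (M + 1))"
          unfolding norm_mult using s d' B by (intro mult_mono) auto
        then show "exp (norm (s * d)) \<le> exp (B * (C1 * W ^ (M + 1)))" by simp
      qed (use B C1_0 in auto)
      finally show ?thesis by (simp only: mult_ac)
    qed
    ultimately have "norm (exp (s * poly (P M) w)) * norm (exp (s * d) - 1) \<le>
        exp (B * (K * W)) * ((B * C1 * exp (B * (C1 * W ^ (M + 1)))) * norm w ^ (M + 1))"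
      by (intro mult_mono) auto
    also have "\<dots> = E * norm w ^ (M + 1)" by (simp only: E_def mult.assoc)
    also have "norm (exp (s * poly (P M) w)) * norm (exp (s * d) - 1) = norm (exp (s * A k) - exp (s * poly (P M) w))"
    proof -
      have "exp (s * A k) = exp (s * poly (P M) w) * exp (s * d)"
        by (simp add: d_def exp_add[symmetric] algebra_simps)
      then have "exp (s * A k) - exp (s * poly (P M) w) = exp (s * poly (P M) w) * (exp (s * d) - 1)"
        by (simp only: right_diff_distrib mult_1_right)
      then show ?thesis by (simp only: norm_mult)
    qed
    finally have 1: "norm (exp (s * A k) - exp (s * poly (P M) w)) \<le> E * norm w ^ (M + 1)" .
    have "norm (r M k s) \<le> E * norm w ^ (M + 1) + C2 * norm w ^ (M + 1)"
      using norm_triangle_mono[OF 1 C2(2)[OF s w]] by (simp add: r_def w_def)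
    then show "norm (r M k s) \<le> (E + C2) * norm (inverse (lam k)) ^ (M + 1)"
      by (simp add: w_def algebra_simps)
  qed
qed

definition H :: "nat \<Rightarrow> complex set" where
  "H M = {s. real n * Re s > \<mu> - real M - 1}"

definition tail :: "nat \<Rightarrow> complex \<Rightarrow> complex" where
  "tail M s = (\<Sum>\<^sub>\<infinity>k\<in>I. exp (- (of_nat n * s * Ln (lam k))) * r M k s)"

lemma tail_facts:
  shows "tail M holomorphic_on H M"
    and "s \<in> H M \<Longrightarrow> ((\<lambda>k. deriv (\<lambda>s. exp (- (of_nat n * s * Ln (lam k))) * r M k s) s) has_sum deriv (tail M) s) I"
    and "s \<in> H M \<Longrightarrow> (\<lambda>k. exp (- (of_nat n * s * Ln (lam k))) * r M k s) summable_on I"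
  unfolding tail_def[abs_def]
  using holomorphic_tail[OF r_holomorphic r_bound H_def] by auto

lemma H_facts: "open (H M)" "connected (H M)" "{s. Re s > \<mu>} \<subseteq> H M"
proof -
  have "real n > 0" using n by simp
  then have eq: "H M = {s. Re s > (\<mu> - real M - 1) / real n}"
    by (auto simp: H_def field_simps)
  show "open (H M)" "connected (H M)"
    unfolding eq by (auto simp: open_halfspace_Re_gt intro: convex_connected convex_halfspace_Re_gt)
  have "real n * Re s \<ge> 1 * Re s" if "Re s > \<mu>" for s
    using n mu_pos that by (intro mult_right_mono) auto
  then show "{s. Re s > \<mu>} \<subseteq> H M"
    by (force simp: H_def)
qed

text \<open>The factor \<open>inverse (lam k) ^ l\<close> merges with the power of exponent
  \<open>- n s\<close> into the principal power of exponent \<open>- (n s + l)\<close>; as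
  \<open>l\<close> is an integer, no branch problem arises. Summing over \<open>k\<close> gives
  shifted copies of the zeta function of \<open>lam\<close>.\<close>

lemma zeta_series_powers:
  assumes s: "Re s > \<mu>"
  shows "(\<lambda>k. powers k s) summable_on I"
    and "zeta_series I powers s =
      (\<Sum>l\<le>M. p M l s * zeta_series I (principal_powers lam) (of_nat n * s + of_nat l)) + tail M s"
proof -
  have sH: "s \<in> H M" for M using H_facts(3) s by blast
  have "real n * Re s \<ge> 1 * Re s"
    using n mu_pos s by (intro mult_right_mono) auto
  then have Re: "Re (of_nat n * s + of_nat l) > \<mu>" for l using s by simp
  define f where "f = (\<lambda>M k. \<Sum>l\<le>M. p M l s * principal_powers lam k (of_nat n * s + of_nat l))"
  define g where "g = (\<lambda>M k. exp (- (of_nat n * s * Ln (lam k))) * r M k s)"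
  have eq: "powers k s = f M k + g M k" if k: "k \<in> I" for k M
  proof -
    have "principal_powers lam k (of_nat n * s + of_nat l) = exp (- (of_nat n * s * Ln (lam k))) * inverse (lam k) ^ l" for l
    proof -
      have "exp (of_nat l * Ln (lam k)) = lam k ^ l"
        using nonzero[OF k] by (simp add: exp_of_nat_mult)
      then show ?thesis
        by (simp add: principal_powers_eq[OF k] distrib_right exp_diff divide_inverse power_inverse)
    qed
    then have "f M k = exp (- (of_nat n * s * Ln (lam k))) * (\<Sum>l\<le>M. p M l s * inverse (lam k) ^ l)"
      by (simp add: f_def sum_distrib_left mult_ac)
    then have "f M k + g M k = exp (- (of_nat n * s * Ln (lam k))) * exp (s * A k)"
      by (simp add: g_def r_def algebra_simps)
    also have "\<dots> = powers k s"
      by (simp add: powers_def exp_add[symmetric] algebra_simps)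
    finally show ?thesis by simp
  qed
  have f: "(f M has_sum (\<Sum>l\<le>M. p M l s * zeta_series I (principal_powers lam) (of_nat n * s + of_nat l))) I" for M
    unfolding f_def zeta_series_def
    by (intro has_sum_finite_sum has_sum_cmult_right has_sum_infsum principal_powers_summable Re) auto
  have g: "g M summable_on I" for M
    unfolding g_def by (rule tail_facts(3)[OF sH])
  show "(\<lambda>k. powers k s) summable_on I"
    using summable_on_add[OF has_sum_imp_summable[OF f[of 0]] g[of 0]] by (subst summable_on_cong[OF eq]) auto
  have "zeta_series I powers s = infsum (\<lambda>k. f M k + g M k) I"
    unfolding zeta_series_def by (rule infsum_cong) (rule eq)
  also have "\<dots> = infsum (f M) I + tail M s"
    using infsum_add[OF has_sum_imp_summable[OF f] g] by (simp add: tail_def g_def)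
  finally show "zeta_series I powers s =
      (\<Sum>l\<le>M. p M l s * zeta_series I (principal_powers lam) (of_nat n * s + of_nat l)) + tail M s"
    using f[of M] by (simp add: has_sum_iff)
qed

end

subsection \<open>The derivative at zero\<close>

text \<open>Laurent data are recorded at the natural numbers only, since near \<open>s = 0\<close>
  the zeta function is evaluated at \<open>n s + l\<close>. There \<open>R l\<close> is the residue,
  zero if there is no pole, and \<open>h l\<close> the regular part.\<close>

locale shifted_zeta = shifted_sequence +
  fixes \<zeta> :: "complex \<Rightarrow> complex" and h :: "nat \<Rightarrow> complex \<Rightarrow> complex" and R :: "nat \<Rightarrow> complex"
  assumes zeta_mero: "\<zeta> meromorphic_on UNIV"
    and zeta_eq: "\<And>s. Re s > \<mu> \<Longrightarrow> \<zeta> s = zeta_series I (principal_powers lam) s"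
    and h: "\<And>l. h l analytic_on {of_nat l}"
    and laurent: "\<And>l. eventually (\<lambda>s. \<zeta> s = R l / (s - of_nat l) + h l s) (at (of_nat l))"
    and R0: "R 0 = 0"
begin

definition local_zeta :: "nat \<Rightarrow> complex \<Rightarrow> complex" where
  "local_zeta M s = (\<Sum>l\<le>M. p M l s * \<zeta> (of_nat n * s + of_nat l)) + tail M s"

lemma local_zeta_meromorphic: "local_zeta M meromorphic_on H M"
proof -
  have "(\<lambda>s. \<zeta> (of_nat n * s + of_nat l)) meromorphic_on H M" for l
    by (rule meromorphic_on_compose[OF zeta_mero]) (auto intro!: analytic_intros)
  moreover have "p M l meromorphic_on H M" for l
    by (intro analytic_on_imp_meromorphic_on) (simp add: analytic_on_open H_facts p_holomorphic)
  moreover have "tail M meromorphic_on H M"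
    by (intro analytic_on_imp_meromorphic_on) (simp add: analytic_on_open H_facts tail_facts)
  ultimately show ?thesis
    unfolding local_zeta_def[abs_def]
    by (intro meromorphic_on_add meromorphic_on_sum meromorphic_on_mult)
qed

lemma local_zeta_eq: "Re s > \<mu> \<Longrightarrow> local_zeta M s = zeta_series I powers s"
proof -
  assume s: "Re s > \<mu>"
  have "real n * Re s \<ge> 1 * Re s"
    using n mu_pos s by (intro mult_right_mono) auto
  then have "\<zeta> (of_nat n * s + of_nat l) = zeta_series I (principal_powers lam) (of_nat n * s + of_nat l)" for l
    using s by (intro zeta_eq) simp
  then show ?thesis
    by (simp add: local_zeta_def zeta_series_powers(2)[OF s, of M])
qed

lemma zeta_continuation_local_zeta: "zeta_continuation I powers (H M) (local_zeta M)"
  unfolding zeta_continuation_def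
  using H_facts local_zeta_meromorphic local_zeta_eq zeta_series_powers(1) by blast

lemma zeta_continuation_powers: "\<exists>G. zeta_continuation I powers UNIV G"
proof -
  \<comment> \<open>The index is chosen so that \<open>Re s > - M\<close> implies
    \<open>n Re s > \<mu> - N M - 1\<close>: \<open>n * M\<close> accounts for the scaling by
    \<open>n\<close>, and \<open>nat \<lceil>\<mu>\<rceil>\<close> for the abscissa.\<close>
  define N where "N = (\<lambda>M. n * M + nat \<lceil>\<mu>\<rceil>)"
  have sub: "{s. Re s > - real M} \<subseteq> H (N M)" for M
  proof
    fix s assume "s \<in> {s. Re s > - real M}"
    then have "real n * Re s \<ge> real n * (- real M)" by (intro mult_left_mono) auto
    moreover have "real (nat \<lceil>\<mu>\<rceil>) \<ge> \<mu>" using mu_pos by linarith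
    ultimately show "s \<in> H (N M)" by (simp add: H_def N_def)
  qed
  have mer: "local_zeta (N M) meromorphic_on {s. Re s > - real M}" for M
    by (rule meromorphic_on_subset[OF local_zeta_meromorphic sub])
  obtain G where "G meromorphic_on UNIV" "\<And>s. Re s > \<mu> \<Longrightarrow> G s = zeta_series I powers s"
    using meromorphic_on_union_of_half_planes[of "\<lambda>M. local_zeta (N M)" \<mu> "zeta_series I powers", OF mer local_zeta_eq]
    by blast
  then show ?thesis
    unfolding zeta_continuation_def using zeta_series_powers(1) by blast
qed

text \<open>The quotient by \<open>s ^ 2\<close> of the part of \<open>p M l\<close> of degree at
  least two in \<open>s\<close>, hence the shift of the index by \<open>2\<close>.\<close>

definition v :: "nat \<Rightarrow> nat \<Rightarrow> complex \<Rightarrow> complex" where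
  "v M l s = (\<Sum>q\<le>M. s ^ q / fact (q + 2) * coeff (P M ^ (q + 2)) l)"

lemma v_analytic: "v M l analytic_on S"
  unfolding v_def[abs_def] by (intro analytic_intros) (simp only: fact_nonzero not_False_eq_True)

lemma v_0: "v M l 0 = coeff (P M ^ 2) l / 2"
proof -
  have "v M l 0 = (\<Sum>q\<in>{0}. 0 ^ q / fact (q + 2) * coeff (P M ^ (q + 2)) l)"
    unfolding v_def by (rule sum.mono_neutral_right) auto
  then show ?thesis by (simp add: numeral_2_eq_2)
qed

lemma p_eq: "p M l s = (if l = 0 then 1 else 0) + s * (if 1 \<le> l \<and> l \<le> M then a l else 0) + s\<^sup>2 * v M l s"
proof -
  define t where "t = (\<lambda>q. s ^ q / fact q * coeff (P M ^ q) l)"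
  have "p M l s = (\<Sum>q\<le>Suc (Suc M). t q)" by (simp add: exp_poly_coeff_def t_def)
  also have "\<dots> = t 0 + (t 1 + (\<Sum>q\<le>M. t (q + 2)))"
    unfolding sum.atMost_Suc_shift[of _ "Suc M"] sum.atMost_Suc_shift[of _ M] by simp
  also have "(\<Sum>q\<le>M. t (q + 2)) = s\<^sup>2 * v M l s"
    by (simp only: v_def t_def sum_distrib_left power_add) (simp add: mult_ac)
  finally show ?thesis by (simp add: t_def coeff_P)
qed

text \<open>\<open>P M\<close> has no constant term, so neither have its positive powers. Hence
  \<open>p M 0\<close> is identically \<open>1\<close>, and \<open>\<zeta> (n s)\<close> enters
  \<open>local_zeta\<close> unchanged.\<close>

lemma v_l0: "v M 0 s = 0"
  unfolding v_def coeff_0_power coeff_P by (rule sum.neutral) (simp del: power_Suc)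

lemma coeff_P_square:
  assumes "l \<le> M"
  shows "coeff (P M ^ 2) l = (\<Sum>r=1..l - 1. a r * a (l - r))"
proof -
  have "coeff (P M ^ 2) l = (\<Sum>r\<le>l. coeff (P M) r * coeff (P M) (l - r))"
    by (simp add: power2_eq_square coeff_mult)
  also have "\<dots> = (\<Sum>r=1..l - 1. coeff (P M) r * coeff (P M) (l - r))"
    by (rule sum.mono_neutral_right) (auto simp: coeff_P not_le)
  also have "\<dots> = (\<Sum>r=1..l - 1. a r * a (l - r))"
    by (rule sum.cong) (use assms in \<open>auto simp: coeff_P\<close>)
  finally show ?thesis .
qed

text \<open>At \<open>s = 0\<close> the factor \<open>r M k\<close> vanishes, so the derivative of
  the power of \<open>lam k\<close> drops out. What remains is the part of \<open>A k\<close> left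
  over by its truncated expansion, which is additive in the sequences.\<close>

lemma deriv_tail_term:
  assumes k: "k \<in> I"
  shows "deriv (\<lambda>s. exp (- (of_nat n * s * Ln (lam k))) * r M k s) 0 = A k - (\<Sum>l=1..M. a l * inverse (lam k) ^ l)"
proof -
  have p': "(p M l has_field_derivative (if 1 \<le> l \<and> l \<le> M then a l else 0)) (at 0)" for l
  proof -
    have "(v M l has_field_derivative deriv (v M l) 0) (at 0)"
      using v_analytic[of M l "{0}"] analytic_on_imp_differentiable_at field_differentiable_derivI by blast
    moreover have "p M l = (\<lambda>s. (if l = 0 then 1 else 0) + s * (if 1 \<le> l \<and> l \<le> M then a l else 0) + s\<^sup>2 * v M l s)"
      by (rule ext) (rule p_eq)
    ultimately show ?thesis
      by (auto intro!: derivative_eq_intros)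
  qed
  have "(r M k has_field_derivative (A k - (\<Sum>l\<le>M. (if 1 \<le> l \<and> l \<le> M then a l else 0) * inverse (lam k) ^ l))) (at 0)"
    unfolding r_def[abs_def]
    by (rule derivative_eq_intros p' refl | simp)+
  also have "(\<Sum>l\<le>M. (if 1 \<le> l \<and> l \<le> M then a l else 0) * inverse (lam k) ^ l) = (\<Sum>l=1..M. a l * inverse (lam k) ^ l)"
    by (rule sum.mono_neutral_cong_right) auto
  finally have r': "(r M k has_field_derivative (A k - (\<Sum>l=1..M. a l * inverse (lam k) ^ l))) (at 0)" .
  have r0: "r M k 0 = 0"
  proof -
    have "(\<Sum>l\<le>M. p M l 0 * inverse (lam k) ^ l) = (\<Sum>l\<in>{0}. p M l 0 * inverse (lam k) ^ l)"
      by (rule sum.mono_neutral_right) (auto simp: p_eq)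
    then show ?thesis by (simp add: r_def p_eq)
  qed
  show ?thesis
    by (rule DERIV_imp_deriv) (rule derivative_eq_intros r' refl | simp add: r0)+
qed

text \<open>For \<open>l \<ge> 1\<close> the zero of \<open>p M l\<close> at \<open>0\<close>
  cancels the pole of \<open>\<zeta> (n s + l)\<close>; thereby the residue meets the coefficient of
  \<open>s ^ 2\<close> in \<open>p M l\<close>, which produces the convolution. The other
  contributions are linear in \<open>A\<close>, in \<open>a\<close> or in \<open>n\<close>. The
  bound on \<open>M\<close> places \<open>0\<close> in \<open>H M\<close>.\<close>

lemma zeta_deriv_0_powers:
  assumes M: "real M + 1 > \<mu>"
  shows "\<exists>T. ((\<lambda>k. A k - (\<Sum>l=1..M. a l * inverse (lam k) ^ l)) has_sum T) I \<and>
    zeta_deriv_0 I powers = of_nat n * deriv (h 0) 0 +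
      (\<Sum>l=1..M. R l / of_nat n * ((\<Sum>r=1..l - 1. a r * a (l - r)) / 2) + a l * h l (of_nat l)) + T"
proof -
  have H0: "0 \<in> H M" using M by (simp add: H_def)
  obtain G where G: "zeta_continuation I powers UNIV G"
    using zeta_continuation_powers by blast
  have n0: "of_nat n \<noteq> (0 :: complex)" using n by simp
  \<comment> \<open>The germ of \<open>local_zeta M\<close> at \<open>0\<close> with its singularity
    removed: a factor \<open>s\<close> of \<open>p M l\<close> is moved into the Laurent expansion
    of \<open>\<zeta> (n s + l)\<close>, and the term \<open>l = 0\<close> has no pole as
    \<open>R 0 = 0\<close>.\<close>
  define g where "g = (\<lambda>s. h 0 (of_nat n * s) +
    (\<Sum>l=1..M. (a l + s * v M l s) * (R l / of_nat n + s * h l (of_nat n * s + of_nat l))) + tail M s)"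
  have ev_l: "eventually (\<lambda>s. \<zeta> (of_nat n * s + of_nat l) = R l / (of_nat n * s) + h l (of_nat n * s + of_nat l)) (at 0)" for l
  proof -
    have "filterlim (\<lambda>s. of_nat n * s + of_nat l :: complex) (at (of_nat l)) (at 0)"
    proof (rule filterlim_atI)
      have "((\<lambda>s. of_nat n * s + of_nat l :: complex) \<longlongrightarrow> of_nat n * 0 + of_nat l) (at 0)"
        by (intro tendsto_intros)
      then show "((\<lambda>s. of_nat n * s + of_nat l :: complex) \<longlongrightarrow> of_nat l) (at 0)" by simp
      show "eventually (\<lambda>s. of_nat n * s + of_nat l \<noteq> (of_nat l :: complex)) (at 0)"
        using eventually_neq_at_within[of 0 0 UNIV] by eventually_elim (use n0 in auto)
    qed
    from eventually_compose_filterlim[OF laurent this] show ?thesis by simp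
  qed
  have "eventually (\<lambda>s. \<forall>l\<in>{..M}. \<zeta> (of_nat n * s + of_nat l) = R l / (of_nat n * s) + h l (of_nat n * s + of_nat l)) (at 0)"
    by (intro eventually_ball_finite) (use ev_l in auto)
  then have local_g: "eventually (\<lambda>s. local_zeta M s = g s) (at 0)"
    using eventually_neq_at_within[of 0 0 UNIV]
  proof eventually_elim
    case (elim s)
    have "p M l s * \<zeta> (of_nat n * s + of_nat l) = (a l + s * v M l s) * (R l / of_nat n + s * h l (of_nat n * s + of_nat l))"
      if l: "l \<in> {1..M}" for l
    proof -
      have "p M l s = s * (a l + s * v M l s)" using l by (simp add: p_eq power2_eq_square algebra_simps)
      moreover have "\<zeta> (of_nat n * s + of_nat l) = (R l / of_nat n + s * h l (of_nat n * s + of_nat l)) / s"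
        using elim l by (simp add: add_divide_distrib)
      ultimately show ?thesis using elim by simp
    qed
    moreover have "p M 0 s * \<zeta> (of_nat n * s + of_nat 0) = h 0 (of_nat n * s)"
      using bspec[OF elim(1), of 0] by (simp add: p_eq v_l0 R0)
    moreover have "{..M} = insert 0 {1..M}" by auto
    ultimately show ?case
      by (simp add: local_zeta_def g_def)
  qed
  moreover have "eventually (\<lambda>s. local_zeta M s = G s) (at 0)"
    by (rule zeta_continuation_eq_eventually[OF zeta_continuation_local_zeta G _ H0]) auto
  ultimately have Gg: "eventually (\<lambda>s. G s = g s) (at 0)"
    by eventually_elim auto
  have hc: "(\<lambda>s. h l (of_nat n * s + of_nat l)) analytic_on {0}" for l
    by (rule analytic_on_compose[of _ _ "h l", unfolded o_def]) (use h[of l] in \<open>auto intro!: analytic_intros\<close>)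
  have hc': "((\<lambda>s. h l (of_nat n * s + of_nat l)) has_field_derivative of_nat n * deriv (h l) (of_nat l)) (at 0)" for l
  proof -
    have "(h l has_field_derivative deriv (h l) (of_nat l)) (at (of_nat l))"
      using h[of l] analytic_on_imp_differentiable_at field_differentiable_derivI by blast
    moreover have "((\<lambda>s. of_nat n * s + of_nat l :: complex) has_field_derivative of_nat n) (at 0)"
      by (auto intro!: derivative_eq_intros)
    ultimately show ?thesis
      using DERIV_chain2[of "h l" "deriv (h l) (of_nat l)" "\<lambda>s. of_nat n * s + of_nat l" 0 "of_nat n" UNIV]
      by (simp add: mult.commute)
  qed
  have tail: "tail M analytic_on {0}"
    by (rule holomorphic_on_imp_analytic_at[OF tail_facts(1) H_facts(1) H0])
  have hc0: "(\<lambda>s. h 0 (of_nat n * s)) analytic_on {0}" using hc[of 0] by simp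
  have gl: "(\<lambda>s. (a l + s * v M l s) * (R l / of_nat n + s * h l (of_nat n * s + of_nat l))) analytic_on {0}" for l
    by (rule analytic_on_mult[OF analytic_on_add[OF analytic_on_const analytic_on_mult[OF analytic_on_ident v_analytic]]
        analytic_on_add[OF analytic_on_const analytic_on_mult[OF analytic_on_ident hc]]])
  have g: "g analytic_on {0}"
    unfolding g_def
    by (rule analytic_on_add[OF analytic_on_add[OF hc0 analytic_on_sum[OF gl]] tail])
  have "zeta_deriv_0 I powers = deriv g 0"
    by (rule zeta_deriv_0_eq[OF G Gg g])
  also have "\<dots> = of_nat n * deriv (h 0) 0 +
      (\<Sum>l=1..M. R l / of_nat n * v M l 0 + a l * h l (of_nat l)) + deriv (tail M) 0"
  proof (rule DERIV_imp_deriv)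
    have d0: "((\<lambda>s. h 0 (of_nat n * s)) has_field_derivative of_nat n * deriv (h 0) 0) (at 0)"
      using hc'[of 0] by simp
    have dt: "(tail M has_field_derivative deriv (tail M) 0) (at 0)"
      using tail analytic_on_imp_differentiable_at field_differentiable_derivI by blast
    have dv: "(v M l has_field_derivative deriv (v M l) 0) (at 0)" for l
      using v_analytic[of M l "{0}"] analytic_on_imp_differentiable_at field_differentiable_derivI by blast
    have d1: "((\<lambda>s. a l + s * v M l s) has_field_derivative v M l 0) (at 0)" for l
      by (rule DERIV_cong[OF DERIV_add[OF DERIV_const DERIV_mult[OF DERIV_ident dv]]]) simp
    have d2: "((\<lambda>s. R l / of_nat n + s * h l (of_nat n * s + of_nat l)) has_field_derivative h l (of_nat l)) (at 0)" for l
      by (rule DERIV_cong[OF DERIV_add[OF DERIV_const DERIV_mult[OF DERIV_ident hc']]]) simp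
    have dl: "((\<lambda>s. (a l + s * v M l s) * (R l / of_nat n + s * h l (of_nat n * s + of_nat l)))
        has_field_derivative R l / of_nat n * v M l 0 + a l * h l (of_nat l)) (at 0)" for l
      by (rule DERIV_cong[OF DERIV_mult[OF d1 d2]]) (simp add: mult.commute)
    show "(g has_field_derivative of_nat n * deriv (h 0) 0 +
      (\<Sum>l=1..M. R l / of_nat n * v M l 0 + a l * h l (of_nat l)) + deriv (tail M) 0) (at 0)"
      unfolding g_def by (rule DERIV_add[OF DERIV_add[OF d0 DERIV_sum[OF dl]] dt])
  qed
  also have "(\<Sum>l=1..M. R l / of_nat n * v M l 0 + a l * h l (of_nat l)) =
      (\<Sum>l=1..M. R l / of_nat n * ((\<Sum>r=1..l - 1. a r * a (l - r)) / 2) + a l * h l (of_nat l))"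
    by (rule sum.cong[OF refl]) (simp only: v_0 coeff_P_square atLeastAtMost_iff)
  finally have "zeta_deriv_0 I powers = of_nat n * deriv (h 0) 0 +
      (\<Sum>l=1..M. R l / of_nat n * ((\<Sum>r=1..l - 1. a r * a (l - r)) / 2) + a l * h l (of_nat l)) + deriv (tail M) 0" .
  moreover have "((\<lambda>k. A k - (\<Sum>l=1..M. a l * inverse (lam k) ^ l)) has_sum deriv (tail M) 0) I"
    by (rule iffD1[OF has_sum_cong tail_facts(2)[OF H0]]) (rule deriv_tail_term)
  ultimately show ?thesis by blast
qed

end

subsection \<open>The discrepancy\<close>

text \<open>The infimum supplies a summable exponent \<open>s\<close> below \<open>x\<close>, and
  \<open>s > 0\<close> since \<open>\<mu>\<close> is positive. Passing to \<open>x\<close> takes an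
  argument because terms may have modulus below \<open>1\<close>: each term of the sum is at most
  \<open>S\<close>, which bounds the extra factor \<open>cmod (a k) powr (s - x)\<close>.\<close>

lemma summable_of_seq_order:
  assumes nz: "\<And>k. k \<in> I \<Longrightarrow> a k \<noteq> 0" and ord: "seq_order I a = ereal \<mu>" and \<mu>: "\<mu> > 0" and x: "x > \<mu>"
  shows "(\<lambda>k. cmod (a k) powr (- x)) summable_on I"
proof -
  let ?T = "{s. (\<lambda>k. cmod (a k) powr (- s)) summable_on I}"
  have "Inf (ereal ` ?T) < ereal x" using ord x by (simp add: seq_order_def)
  then obtain s where s: "(\<lambda>k. cmod (a k) powr (- s)) summable_on I" "s < x"
    unfolding Inf_less_iff by auto
  have "Inf (ereal ` ?T) \<le> ereal s" by (rule Inf_lower) (use s in auto)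
  then have "s > 0" using ord \<mu> by (simp add: seq_order_def)
  define S where "S = (\<Sum>\<^sub>\<infinity>k\<in>I. cmod (a k) powr (- s))"
  have le: "cmod (a k) powr (- x) \<le> S powr ((x - s) / s) * cmod (a k) powr (- s)" if k: "k \<in> I" for k
  proof -
    have "(\<Sum>k\<in>{k}. cmod (a k) powr (- s)) \<le> S"
      unfolding S_def by (rule finite_sum_le_infsum[OF s(1)]) (use k in auto)
    then have "cmod (a k) powr (- s) \<le> S" by simp
    then have "(cmod (a k) powr (- s)) powr ((x - s) / s) \<le> S powr ((x - s) / s)"
      using s \<open>s > 0\<close> by (intro powr_mono2) auto
    moreover have "(cmod (a k) powr (- s)) powr ((x - s) / s) = cmod (a k) powr (s - x)"
      using \<open>s > 0\<close> by (simp only: powr_powr) simp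
    ultimately have "cmod (a k) powr (s - x) * cmod (a k) powr (- s) \<le> S powr ((x - s) / s) * cmod (a k) powr (- s)"
      by (intro mult_right_mono) auto
    then show ?thesis by (simp add: powr_add[symmetric])
  qed
  show ?thesis
    by (rule summable_on_comparison_test[OF summable_on_cmult_right[OF s(1)]]) (use le in auto)
qed

section \<open>Logarithms of the shifted terms\<close>

lemma Ln_Taylor_bound:
  assumes u: "norm u \<le> 1 / 2"
  shows "norm (- Ln (1 - u) - (\<Sum>l=1..M. u ^ l / of_nat l)) \<le> 2 * norm u ^ (M + 1)"
proof -
  have "(\<lambda>k. u ^ k / of_nat k) sums - Ln (1 - u)"
    using sums_minus[OF Ln_series[of "-u"]] assms by (simp add: power_minus')
  then have "(\<lambda>k. u ^ (k + Suc M) / of_nat (k + Suc M)) sums (- Ln (1 - u) - (\<Sum>k<Suc M. u ^ k / of_nat k))"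
    by (intro sums_split_initial_segment)
  \<comment> \<open>The term for \<open>k = 0\<close> is a division by zero and hence
    \<open>0\<close>, so the sum may start at \<open>1\<close>.\<close>
  also have "(\<Sum>k<Suc M. u ^ k / of_nat k) = (\<Sum>l=1..M. u ^ l / of_nat l)"
    by (intro sum.mono_neutral_right) auto
  finally have eq: "- Ln (1 - u) - (\<Sum>l=1..M. u ^ l / of_nat l) = (\<Sum>k. u ^ (k + Suc M) / of_nat (k + Suc M))"
    by (simp add: sums_iff)
  have geo: "(\<lambda>k. norm u ^ (M + 1) * (1 / 2) ^ k) sums (norm u ^ (M + 1) * 2)"
    using sums_mult[OF geometric_sums[of "1 / 2 :: real"]] by simp
  have "norm (\<Sum>k. u ^ (k + Suc M) / of_nat (k + Suc M)) \<le> (\<Sum>k. norm u ^ (M + 1) * (1 / 2) ^ k)"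
  proof (rule norm_suminf_le)
    fix k
    have "norm (u ^ (k + Suc M) / of_nat (k + Suc M)) \<le> norm u ^ (k + Suc M) / 1"
      unfolding norm_divide norm_power norm_of_nat by (intro divide_left_mono) auto
    also have "\<dots> = norm u ^ (M + 1) * norm u ^ k" by (simp add: power_add)
    also have "\<dots> \<le> norm u ^ (M + 1) * (1 / 2) ^ k"
      by (intro mult_left_mono power_mono u) auto
    finally show "norm (u ^ (k + Suc M) / of_nat (k + Suc M)) \<le> norm u ^ (M + 1) * (1 / 2) ^ k" .
  qed (use geo sums_summable in blast)
  also have "\<dots> = norm u ^ (M + 1) * 2" using geo by (rule sums_unique[symmetric])
  finally show ?thesis unfolding eq by (simp add: mult.commute)
qed

text \<open>If \<open>cmod (lam k) > 2 * cmod z\<close>, the logarithm is prescribed and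
  \<open>z / lam k\<close> has modulus at most \<open>1 / 2\<close>, so the Taylor bound applies.
  Only finitely many terms remain, and their errors, whatever the branches, are absorbed by the
  constant.\<close>

lemma (in order_sequence) shifted_logs_expansion:
  assumes L: "shifted_logs I lam z L"
  shows "\<exists>C. \<forall>k\<in>I. norm ((Ln (lam k) - L k) - (\<Sum>l=1..M. z ^ l / of_nat l * inverse (lam k) ^ l))
    \<le> C * norm (inverse (lam k)) ^ (M + 1)"
proof -
  define E where "E = (\<lambda>k. norm ((Ln (lam k) - L k) - (\<Sum>l=1..M. z ^ l / of_nat l * inverse (lam k) ^ l)))"
  define X where "X = {k \<in> I. cmod (lam k) \<le> 2 * cmod z}"
  have X: "finite X" unfolding X_def by (rule finite_norm_le)
  define w where "w = (\<lambda>k. norm (inverse (lam k)) ^ (M + 1))"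
  have w: "w k > 0" if "k \<in> I" for k using nonzero[OF that] by (simp add: w_def)
  define C where "C = 2 * norm z ^ (M + 1) + (\<Sum>k\<in>X. E k / w k)"
  have pos: "E k / w k \<ge> 0" if "k \<in> I" for k using w[OF that] by (simp add: E_def)
  have "E k \<le> C * w k" if k: "k \<in> I" for k
  proof (cases "k \<in> X")
    case True
    then have "E k / w k \<le> (\<Sum>k\<in>X. E k / w k)"
      by (intro member_le_sum pos X) (auto simp: X_def)
    then have "E k / w k \<le> C" by (simp add: C_def add_increasing)
    then show ?thesis using w[OF k] by (simp add: field_simps)
  next
    case False
    then have lz: "cmod (lam k) > 2 * cmod z" using k by (auto simp: X_def)
    then have gt: "cmod (lam k) > cmod z" by (smt (verit) norm_ge_zero)
    then have Lk: "Ln (lam k) - L k = - Ln (1 - z / lam k)"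
      using L k by (auto simp: shifted_logs_def)
    have "cmod (lam k) > 0" using nonzero[OF k] by simp
    with lz have "norm (z / lam k) \<le> 1 / 2" by (simp add: norm_divide field_simps)
    then have "norm (- Ln (1 - z / lam k) - (\<Sum>l=1..M. (z / lam k) ^ l / of_nat l)) \<le> 2 * norm (z / lam k) ^ (M + 1)"
      by (rule Ln_Taylor_bound)
    also have "2 * norm (z / lam k) ^ (M + 1) = 2 * norm z ^ (M + 1) * w k"
      by (simp only: w_def divide_inverse norm_mult power_mult_distrib mult.assoc)
    also have "- Ln (1 - z / lam k) - (\<Sum>l=1..M. (z / lam k) ^ l / of_nat l) =
        (Ln (lam k) - L k) - (\<Sum>l=1..M. z ^ l / of_nat l * inverse (lam k) ^ l)"
      unfolding Lk by (simp add: divide_inverse power_mult_distrib mult_ac)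
    finally have "E k \<le> 2 * norm z ^ (M + 1) * w k" by (simp only: E_def)
    also have "\<dots> \<le> C * w k"
    proof (rule mult_right_mono)
      have "(\<Sum>k\<in>X. E k / w k) \<ge> 0" by (rule sum_nonneg) (use pos in \<open>auto simp: X_def\<close>)
      then show "2 * norm z ^ (M + 1) \<le> C" by (simp add: C_def)
    qed (use w[OF k] in simp)
    finally show ?thesis .
  qed
  then show ?thesis unfolding E_def w_def by blast
qed

section \<open>Algebra of the quadratic terms\<close>

lemma sum_square_symmetric:
  fixes X :: "nat \<Rightarrow> nat \<Rightarrow> complex"
  assumes "\<And>i j. X i j = X j i"
  shows "(\<Sum>i=1..n. \<Sum>j=1..n. X i j) = (\<Sum>j=1..n. X j j) + 2 * (\<Sum>i=1..n. \<Sum>j\<in>{i<..n}. X i j)"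
proof (induction n)
  case (Suc n)
  have "(\<Sum>i=1..n. \<Sum>j\<in>{i<..Suc n}. X i j) = (\<Sum>i=1..n. (\<Sum>j\<in>{i<..n}. X i j) + X i (Suc n))"
  proof (rule sum.cong)
    fix i assume "i \<in> {1..n}"
    then have "{i<..Suc n} = insert (Suc n) {i<..n}" by auto
    then show "(\<Sum>j\<in>{i<..Suc n}. X i j) = (\<Sum>j\<in>{i<..n}. X i j) + X i (Suc n)" by simp
  qed auto
  moreover have "(\<Sum>j=1..n. X (Suc n) j) = (\<Sum>j=1..n. X j (Suc n))"
    by (rule sum.cong) (use assms in auto)
  ultimately show ?case using Suc by (simp add: sum.distrib algebra_simps)
qed simp

lemma sum_rev_convolution:
  "(\<Sum>r=1..l - 1. g r (l - r)) = (\<Sum>r=1..l - 1. g (l - r) (r :: nat))"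
  by (rule sum.reindex_bij_witness[of _ "\<lambda>r. l - r" "\<lambda>r. l - r"]) auto

text \<open>By partial fractions \<open>1 / (r (l - r))\<close> is \<open>1 / l\<close> times
  \<open>1 / r + 1 / (l - r)\<close>, and reversing the sum makes both parts equal. This is the
  source of the harmonic numbers.\<close>

lemma harm_convolution:
  assumes "l \<ge> 1"
  shows "(\<Sum>r=1..l - 1. (z ^ r / of_nat r) * (z ^ (l - r) / of_nat (l - r))) = 2 * (harm (l - 1) / of_nat l * (z :: complex) ^ l)"
proof -
  have "(z ^ r / of_nat r) * (z ^ (l - r) / of_nat (l - r)) = z ^ l / of_nat l * (1 / of_nat r + 1 / of_nat (l - r))"
    if "r \<in> {1..l - 1}" for r
  proof -
    have rl: "r + (l - r) = l" using that by auto
    then have "z ^ r * z ^ (l - r) = z ^ l" by (simp only: power_add[symmetric])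
    moreover have "(of_nat l :: complex) = of_nat r + of_nat (l - r)" by (simp only: of_nat_add[symmetric] rl)
    moreover have "(of_nat r :: complex) \<noteq> 0" "(of_nat (l - r) :: complex) \<noteq> 0" "(of_nat l :: complex) \<noteq> 0"
      using that by auto
    moreover have "c / (x * y) = c / (x + y) * (1 / x + 1 / y)"
      if "x \<noteq> 0" "y \<noteq> 0" "x + y \<noteq> 0" for c x y :: complex
      using that by (simp add: add_frac_eq add.commute)
    ultimately show ?thesis by (simp only: times_divide_times_eq)
  qed
  then have "(\<Sum>r=1..l - 1. (z ^ r / of_nat r) * (z ^ (l - r) / of_nat (l - r))) =
      z ^ l / of_nat l * ((\<Sum>r=1..l - 1. 1 / of_nat r) + (\<Sum>r=1..l - 1. 1 / of_nat (l - r)))"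
    by (simp only: sum.distrib[symmetric] sum_distrib_left cong: sum.cong)
  also have "(\<Sum>r=1..l - 1. 1 / of_nat (l - r)) = (\<Sum>r=1..l - 1. 1 / of_nat r :: complex)"
    using sum_rev_convolution[of "\<lambda>i j. 1 / of_nat j" l] .
  finally show ?thesis by (simp add: harm_def inverse_eq_divide)
qed

text \<open>The convolution of the sums over \<open>j\<close> is a double sum of symmetric terms
  \<open>X i j\<close>: its diagonal is \<open>2 * h\<close> by \<open>harm_convolution\<close>, and
  its off-diagonal part is twice the sum \<open>Y\<close> over \<open>i < j\<close>. What remains is
  \<open>h - (h + Y) / n\<close>.\<close>

lemma discrepancy_coefficient:
  fixes z :: "nat \<Rightarrow> complex"
  assumes n: "n \<ge> 1" and l: "l \<ge> 1"
  shows "(\<Sum>j=1..n. (\<Sum>r=1..l - 1. (z j ^ r / of_nat r) * (z j ^ (l - r) / of_nat (l - r))) / 2)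
      - (\<Sum>r=1..l - 1. (\<Sum>j=1..n. z j ^ r / of_nat r) * (\<Sum>j=1..n. z j ^ (l - r) / of_nat (l - r))) / 2 / of_nat n =
    (1 - 1 / of_nat n) * (\<Sum>j=1..n. harm (l - 1) / of_nat l * z j ^ l)
      - 1 / of_nat n * (\<Sum>i=1..n. \<Sum>j\<in>{i<..n}. \<Sum>r=1..l - 1. z i ^ r * z j ^ (l - r) / (of_nat r * of_nat (l - r)))"
proof -
  define X where "X = (\<lambda>i j. \<Sum>r=1..l - 1. (z i ^ r / of_nat r) * (z j ^ (l - r) / of_nat (l - r)))"
  have X_sym: "X i j = X j i" for i j
    unfolding X_def using sum_rev_convolution[of "\<lambda>r t. (z i ^ r / of_nat r) * (z j ^ t / of_nat t)" l]
    by (simp only: mult.commute)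
  define h where "h = (\<Sum>j=1..n. harm (l - 1) / of_nat l * z j ^ l)"
  define Y where "Y = (\<Sum>i=1..n. \<Sum>j\<in>{i<..n}. X i j)"
  have diag: "(\<Sum>j=1..n. X j j) = 2 * h"
    unfolding X_def h_def by (simp only: harm_convolution[OF l] sum_distrib_left)
  have "(\<Sum>r=1..l - 1. (\<Sum>j=1..n. z j ^ r / of_nat r) * (\<Sum>j=1..n. z j ^ (l - r) / of_nat (l - r))) =
      (\<Sum>r=1..l - 1. \<Sum>i=1..n. \<Sum>j=1..n. (z i ^ r / of_nat r) * (z j ^ (l - r) / of_nat (l - r)))"
    by (simp only: sum_product)
  also have "\<dots> = (\<Sum>i=1..n. \<Sum>r=1..l - 1. \<Sum>j=1..n. (z i ^ r / of_nat r) * (z j ^ (l - r) / of_nat (l - r)))"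
    by (rule sum.swap)
  also have "\<dots> = (\<Sum>i=1..n. \<Sum>j=1..n. X i j)"
    unfolding X_def by (intro sum.cong refl sum.swap)
  also have "\<dots> = 2 * h + 2 * Y"
    unfolding sum_square_symmetric[of X, OF X_sym] diag Y_def ..
  finally have 1: "(\<Sum>r=1..l - 1. (\<Sum>j=1..n. z j ^ r / of_nat r) * (\<Sum>j=1..n. z j ^ (l - r) / of_nat (l - r))) = 2 * h + 2 * Y" .
  have 2: "(\<Sum>j=1..n. (\<Sum>r=1..l - 1. (z j ^ r / of_nat r) * (z j ^ (l - r) / of_nat (l - r))) / 2) = h"
    using diag by (simp add: X_def sum_divide_distrib[symmetric])
  have 3: "(\<Sum>i=1..n. \<Sum>j\<in>{i<..n}. \<Sum>r=1..l - 1. z i ^ r * z j ^ (l - r) / (of_nat r * of_nat (l - r))) = Y"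
    by (simp add: Y_def X_def)
  show ?thesis
    unfolding 1 2 3 h_def[symmetric] using n by (simp add: field_simps)
qed

theorem corollary2p4:
  fixes I :: "'i set" and lam :: "'i \<Rightarrow> complex" and \<mu> :: real
    and e :: "nat \<Rightarrow> real" and c :: "nat \<Rightarrow> complex"
    and n m :: nat and z :: "nat \<Rightarrow> complex" and L :: "nat \<Rightarrow> 'i \<Rightarrow> complex"
  defines "R \<equiv> \<lambda>l::nat. zeta_residue I (principal_powers lam) (of_nat l)"
  assumes "countable I"
    and "\<And>k. k \<in> I \<Longrightarrow> lam k \<noteq> 0"
    and "seq_order I lam = ereal \<mu>" and "\<mu> > 0"
    and "regularizable I (principal_powers lam)"
    and "\<And>t. t > 0 \<Longrightarrow> (\<lambda>k. exp (- (of_real t * lam k))) summable_on I"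
    and "\<And>s. Re s > \<mu> \<Longrightarrow>
           set_integrable lborel {0<..} (\<lambda>t. theta_series I lam t * of_real t powr (s - 1))"
    and "\<And>s. Re s > \<mu> \<Longrightarrow>
           zeta_series I (principal_powers lam) s =
             1 / Gamma s * (LBINT t:{0<..}. theta_series I lam t * of_real t powr (s - 1))"
    and "strict_mono e" and "e 0 < 0" and "filterlim e at_top sequentially" and "- e 0 = \<mu>"
    and "\<And>N. (\<lambda>t. theta_series I lam t - (\<Sum>i\<le>N. c i * of_real (t powr e i)))
              \<in> o[at_right 0](\<lambda>t. of_real (t powr e N))"
    and "m = nat \<lfloor>\<mu>\<rfloor>"
    and "n \<ge> 1"
    and "\<And>j. j \<in> {1..n} \<Longrightarrow> z j \<notin> lam ` I"
    and "\<And>j. j \<in> {1..n} \<Longrightarrow> shifted_logs I lam (z j) (L j)"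
  shows "discrepancy I n L =
      (1 - 1 / of_nat n) * (\<Sum>j=1..n. \<Sum>l=2..m. R l * harm (l - 1) / of_nat l * z j ^ l)
      - 1 / of_nat n *
          (\<Sum>j1=1..n. \<Sum>j2\<in>{j1<..n}. \<Sum>l=2..m. \<Sum>r=1..l-1.
             R l * z j1 ^ r * z j2 ^ (l - r) / (of_nat r * of_nat (l - r)))"
proof -
  note nz = assms(3) and ord = assms(4) and \<mu> = assms(5)
  interpret O: order_sequence I lam \<mu>
    by unfold_locales (use nz \<mu> summable_of_seq_order[OF nz ord \<mu>] in auto)
  have e0: "- e 0 = \<mu>" by (fact assms(13))
  interpret T: mellin_asymptotics "theta_series I lam" e c
    by unfold_locales (use assms(8,10,14) e0 in auto)
  have Z: "zeta_series I (principal_powers lam) s =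
      1 / Gamma s * (LBINT t:{0<..}. theta_series I lam t * of_real t powr (s - 1))" if "Re s > - e 0" for s
    using assms(9)[of s] that e0 by simp
  obtain \<zeta> where mer: "\<zeta> meromorphic_on UNIV" and \<zeta>: "\<And>s. Re s > - e 0 \<Longrightarrow> \<zeta> s = zeta_series I (principal_powers lam) s"
    and pole: "\<And>w. \<exists>h. h analytic_on {w} \<and> eventually (\<lambda>s. \<zeta> s = residue \<zeta> w / (s - w) + h s) (at w)"
    and res0: "residue \<zeta> 0 = 0"
    using T.zeta_meromorphic_continuation[of "zeta_series I (principal_powers lam)", OF assms(12) Z] by blast
  \<comment> \<open>The residues in the statement refer to a chosen continuation; uniqueness
    identifies them with those of the continuation obtained from the Mellin transform.\<close>
  have "zeta_continuation I (principal_powers lam) UNIV \<zeta>"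
    unfolding zeta_continuation_def
    using mer \<zeta> O.principal_powers_summable e0 by auto
  then have R: "R l = residue \<zeta> (of_nat l)" for l
    unfolding R_def by (rule zeta_residue_eq)
  have "\<forall>l. \<exists>h. h analytic_on {of_nat l} \<and>
      eventually (\<lambda>s. \<zeta> s = R l / (s - of_nat l) + h s) (at (of_nat l))"
    unfolding R using pole by blast
  then obtain h where h: "\<And>l. h l analytic_on {of_nat l}"
      "\<And>l. eventually (\<lambda>s. \<zeta> s = R l / (s - of_nat l) + h l s) (at (of_nat l))"
    by metis
  have R0: "R 0 = 0" using res0 by (simp add: R)
  \<comment> \<open>Truncation order \<open>m\<close> suffices: it places \<open>0\<close> in the
    half-plane where the tails converge.\<close>
  have m: "real m + 1 > \<mu>" using assms(15) by linarith
  define a where "a = (\<lambda>j l. z j ^ l / of_nat l :: complex)"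
  define A where "A = (\<lambda>j k. Ln (lam k) - L j k)"
  have A_bound: "\<exists>C. \<forall>k\<in>I. norm (A j k - (\<Sum>l=1..M. a j l * inverse (lam k) ^ l)) \<le> C * norm (inverse (lam k)) ^ (M + 1)"
    if "j \<in> {1..n}" for j M
    unfolding A_def a_def by (rule O.shifted_logs_expansion) (rule assms(18)[OF that])

  define T where "T = (\<lambda>j. \<Sum>\<^sub>\<infinity>k\<in>I. A j k - (\<Sum>l=1..m. a j l * inverse (lam k) ^ l))"
  have single: "((\<lambda>k. A j k - (\<Sum>l=1..m. a j l * inverse (lam k) ^ l)) has_sum T j) I"
      "zeta_deriv_0 I (log_powers (L j)) = deriv (h 0) 0 +
        (\<Sum>l=1..m. R l * ((\<Sum>r=1..l - 1. a j r * a j (l - r)) / 2) + a j l * h l (of_nat l)) + T j"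
    if j: "j \<in> {1..n}" for j
  proof -
    interpret S: shifted_zeta I lam \<mu> 1 "A j" "a j" \<zeta> h R
      by unfold_locales (use A_bound[OF j] mer \<zeta> e0 h R0 in auto)
    have pw: "S.powers = log_powers (L j)"
      unfolding S.powers_def[abs_def] log_powers_def[abs_def] by (simp add: A_def)
    obtain T' where T': "((\<lambda>k. A j k - (\<Sum>l=1..m. a j l * inverse (lam k) ^ l)) has_sum T') I"
      and eq: "zeta_deriv_0 I (log_powers (L j)) = of_nat 1 * deriv (h 0) 0 +
        (\<Sum>l=1..m. R l / of_nat 1 * ((\<Sum>r=1..l - 1. a j r * a j (l - r)) / 2) + a j l * h l (of_nat l)) + T'"
      using S.zeta_deriv_0_powers[OF m] unfolding pw by (elim exE conjE)
    have "T' = T j" unfolding T_def using T' by (rule infsumI[symmetric])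
    then show "((\<lambda>k. A j k - (\<Sum>l=1..m. a j l * inverse (lam k) ^ l)) has_sum T j) I"
      "zeta_deriv_0 I (log_powers (L j)) = deriv (h 0) 0 +
        (\<Sum>l=1..m. R l * ((\<Sum>r=1..l - 1. a j r * a j (l - r)) / 2) + a j l * h l (of_nat l)) + T j"
      using T' eq by simp_all
  qed

  define A' where "A' = (\<lambda>k. \<Sum>j=1..n. A j k)"
  define a' where "a' = (\<lambda>l. \<Sum>j=1..n. a j l)"
  \<comment> \<open>Logarithms and expansion coefficients both add up over the factors, so the tail
    of the product sequence is the sum of the single tails.\<close>
  have A'_diff: "A' k - (\<Sum>l=1..M. a' l * inverse (lam k) ^ l) =
      (\<Sum>j=1..n. A j k - (\<Sum>l=1..M. a j l * inverse (lam k) ^ l))" for k M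
    unfolding A'_def a'_def sum_subtractf sum_distrib_right by (subst sum.swap) (rule refl)
  have A'_bound: "\<exists>C. \<forall>k\<in>I. norm (A' k - (\<Sum>l=1..M. a' l * inverse (lam k) ^ l)) \<le> C * norm (inverse (lam k)) ^ (M + 1)" for M
  proof -
    obtain C where C: "\<And>j k. j \<in> {1..n} \<Longrightarrow> k \<in> I \<Longrightarrow>
        norm (A j k - (\<Sum>l=1..M. a j l * inverse (lam k) ^ l)) \<le> C j * norm (inverse (lam k)) ^ (M + 1)"
    proof -
      have "\<forall>j\<in>{1..n}. \<exists>C. \<forall>k\<in>I. norm (A j k - (\<Sum>l=1..M. a j l * inverse (lam k) ^ l)) \<le> C * norm (inverse (lam k)) ^ (M + 1)"
        using A_bound by blast
      from bchoice[OF this] show ?thesis using that by blast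
    qed
    show ?thesis
      unfolding A'_diff
      by (intro exI[of _ "\<Sum>j=1..n. C j"] ballI order_trans[OF norm_sum])
         (simp only: sum_distrib_right, intro sum_mono C)
  qed
  interpret S: shifted_zeta I lam \<mu> n A' a' \<zeta> h R
    by unfold_locales (use A'_bound assms(16) mer \<zeta> e0 h R0 in auto)
  have pw: "S.powers = (\<lambda>k s. \<Prod>j=1..n. log_powers (L j) k s)"
    unfolding S.powers_def[abs_def] log_powers_def
    by (simp add: A'_def A_def exp_sum[symmetric] sum_subtractf sum_distrib_left sum_negf)
  have T_sum: "((\<lambda>k. A' k - (\<Sum>l=1..m. a' l * inverse (lam k) ^ l)) has_sum (\<Sum>j=1..n. T j)) I"
    unfolding A'_diff by (rule has_sum_finite_sum) (use single(1) in auto)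
  obtain T' where T': "((\<lambda>k. A' k - (\<Sum>l=1..m. a' l * inverse (lam k) ^ l)) has_sum T') I"
    and eq: "zeta_deriv_0 I S.powers = of_nat n * deriv (h 0) 0 +
      (\<Sum>l=1..m. R l / of_nat n * ((\<Sum>r=1..l - 1. a' r * a' (l - r)) / 2) + a' l * h l (of_nat l)) + T'"
    using S.zeta_deriv_0_powers[OF m] by (elim exE conjE)
  have "T' = (\<Sum>j=1..n. T j)" by (rule has_sum_unique[OF T' T_sum])
  with eq have prod: "zeta_deriv_0 I (\<lambda>k s. \<Prod>j=1..n. log_powers (L j) k s) =
      of_nat n * deriv (h 0) 0 +
      (\<Sum>l=1..m. R l / of_nat n * ((\<Sum>r=1..l - 1. a' r * a' (l - r)) / 2) + a' l * h l (of_nat l)) + (\<Sum>j=1..n. T j)"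
    by (simp only: pw)

  \<comment> \<open>\<open>q l\<close> collects what multiplies \<open>R l\<close> explicitly; the
    contributions of \<open>deriv (h 0) 0\<close>, of the values \<open>h l (of_nat l)\<close> and
    of the tails are the same on both sides and cancel.\<close>
  define q where "q = (\<lambda>l. (\<Sum>j=1..n. (\<Sum>r=1..l - 1. a j r * a j (l - r)) / 2) -
      (\<Sum>r=1..l - 1. a' r * a' (l - r)) / 2 / of_nat n)"
  have "(\<Sum>j=1..n. zeta_deriv_0 I (log_powers (L j))) = of_nat n * deriv (h 0) 0 +
      (\<Sum>j=1..n. \<Sum>l=1..m. R l * ((\<Sum>r=1..l - 1. a j r * a j (l - r)) / 2) + a j l * h l (of_nat l)) + (\<Sum>j=1..n. T j)"
    by (simp add: single(2) sum.distrib)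
  also have "(\<Sum>j=1..n. \<Sum>l=1..m. R l * ((\<Sum>r=1..l - 1. a j r * a j (l - r)) / 2) + a j l * h l (of_nat l)) =
      (\<Sum>l=1..m. R l * (\<Sum>j=1..n. (\<Sum>r=1..l - 1. a j r * a j (l - r)) / 2) + a' l * h l (of_nat l))"
    by (subst sum.swap) (simp only: sum.distrib a'_def sum_distrib_left sum_distrib_right)
  finally have "discrepancy I n L = (\<Sum>l=1..m. R l * q l)"
    unfolding discrepancy_def prod q_def by (simp add: sum_subtractf[symmetric] sum.distrib right_diff_distrib mult.commute[of _ 2])
  \<comment> \<open>For \<open>l = 1\<close> the convolutions run over the empty range
    \<open>{1..0}\<close>.\<close>
  also have "\<dots> = (\<Sum>l=2..m. R l * q l)"
    by (rule sum.mono_neutral_right) (auto simp: q_def not_le)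
  also have "\<dots> = (\<Sum>l=2..m. R l * ((1 - 1 / of_nat n) * (\<Sum>j=1..n. harm (l - 1) / of_nat l * z j ^ l)
      - 1 / of_nat n * (\<Sum>i=1..n. \<Sum>j\<in>{i<..n}. \<Sum>r=1..l - 1. z i ^ r * z j ^ (l - r) / (of_nat r * of_nat (l - r)))))"
    unfolding q_def a_def a'_def
    by (intro sum.cong arg_cong2[where f = "(*)"] refl discrepancy_coefficient assms(16)) auto
  also have "\<dots> = (1 - 1 / of_nat n) * (\<Sum>l=2..m. \<Sum>j=1..n. R l * harm (l - 1) / of_nat l * z j ^ l)
      - 1 / of_nat n * (\<Sum>l=2..m. \<Sum>i=1..n. \<Sum>j\<in>{i<..n}. \<Sum>r=1..l - 1.
          R l * z i ^ r * z j ^ (l - r) / (of_nat r * of_nat (l - r)))"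
    by (simp add: sum_distrib_left sum_subtractf right_diff_distrib mult_ac)
  also have "(\<Sum>l=2..m. \<Sum>j=1..n. R l * harm (l - 1) / of_nat l * z j ^ l) =
      (\<Sum>j=1..n. \<Sum>l=2..m. R l * harm (l - 1) / of_nat l * z j ^ l)"
    by (rule sum.swap)
  also have "(\<Sum>l=2..m. \<Sum>i=1..n. \<Sum>j\<in>{i<..n}. \<Sum>r=1..l - 1.
          R l * z i ^ r * z j ^ (l - r) / (of_nat r * of_nat (l - r))) =
      (\<Sum>i=1..n. \<Sum>l=2..m. \<Sum>j\<in>{i<..n}. \<Sum>r=1..l - 1.
          R l * z i ^ r * z j ^ (l - r) / (of_nat r * of_nat (l - r)))"
    by (rule sum.swap)
  also have "\<dots> = (\<Sum>i=1..n. \<Sum>j\<in>{i<..n}. \<Sum>l=2..m. \<Sum>r=1..l - 1.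
          R l * z i ^ r * z j ^ (l - r) / (of_nat r * of_nat (l - r)))"
    by (intro sum.cong refl sum.swap)
  finally show ?thesis .
qed

end
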